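(* (Discrete quantum filtering equation for homodyne detection.) Consider the repeated interaction model described in the context with homodyne observations $\Delta Y(l)=U(l)^*(\Delta A(l)+\Delta A^*(l))U(l)$, and let $\pi_l(X)=\mathbb{P}(j_l(X)|\mathscr{Y}_l)$ for $X\in\mathscr{M}$, $0\le l\le k$. For $X\in\mathscr{M}$ put $$\mathcal{L}(X)=M^{+*}XM^++\lambda^2M^{\circ*}XM^\circ+M^{\circ*}X+XM^\circ,$$ $$\mathcal{J}(X)=XM^++M^{+*}X+\lambda^2M^{\circ*}XM^++\lambda^2M^{+*}XM^\circ .$$ Then for every $X\in\mathscr{M}$ and $1\le l\le k$, $\Delta\pi_l(X)=\pi_l(X)-\pi_{l-1}(X)$ satisfies (with probability one) $$\Delta\pi_l(X)=\pi_{l-1}(\mathcal{L}(X))\,\Delta t(l)+\frac{\pi_{l-1}(\mathcal{J}(X))-\pi_{l-1}(X+\lambda^2\mathcal{L}(X))\,\pi_{l-1}(\mathcal{J}(I))}{I-\lambda^2\pi_{l-1}(\mathcal{J}(I))^2}\,\bigl(\Delta Y(l)-\pi_{l-1}(\mathcal{J}(I))\,\Delta t(l)\bigr).$$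
   Context: Let $\mathscr{M}=M_2(\mathbb{C})$, $\sigma_-=\begin{pmatrix}0&0\\1&0\end{pmatrix}$, $\sigma_+=\sigma_-^*$, $\Phi=(0,1)^T$, $\phi(X)=\langle\Phi,X\Phi\rangle$. Fix $k\in\mathbb{N}$, $T>0$, $\lambda=\sqrt{T/k}$, a state $\rho$ on $\mathscr{M}$, $\mathscr{W}_k=\mathscr{M}^{\otimes k}$, and the state $\mathbb{P}=\rho\otimes\phi^{\otimes k}$ on $\mathscr{M}\otimes\mathscr{W}_k$. Identify $X\in\mathscr{M}$ with $X\otimes I$ (initial system). For $X\in\mathscr{M}$, $X_i$ denotes $X$ placed in the $i$-th factor of $\mathscr{W}_k$ (identity elsewhere). Set $\Delta A(i)=\lambda(\sigma_-)_i$, $\Delta A^*(i)=\lambda(\sigma_+)_i$, $\Delta\Lambda(i)=(\sigma_+\sigma_-)_i$, $\Delta t(i)=\lambda^2I$. Repeated interaction: given $L_1,L_2,L_3\in\mathscr{M}$ with $L_1,L_3$ self-adjoint, let $M_l=\exp(-i\{L_1\Delta\Lambda(l)+L_2\Delta A^*(l)+L_2^*\Delta A(l)+L_3\Delta t(l)\})$, and let $M^{\pm},M^+,M^-,M^\circ\in\mathscr{M}$ be the unique matrices (independent of $l$) with $M_l-I=M^\pm\Delta\Lambda(l)+M^+\Delta A^*(l)+M^-\Delta A(l)+M^\circ\Delta t(l)$. Put $U(0)=I$, $U(l)=M_lM_{l-1}\cdots M_1$, $j_l(X)=U(l)^*XU(l)$. $\mathscr{Y}_l$ is the $^*$-algebra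 generated by $I,\Delta Y(1),\ldots,\Delta Y(l)$ (so $\mathscr{Y}_0=\mathbb{C}I$); it is commutative and $j_l(X)$ commutes with $\mathscr{Y}_l$ for all $X\in\mathscr{M}$. Conditional expectation: for a commutative $^*$-subalgebra $\mathscr{C}$ with commutant $\mathscr{C}'$ and $B\in\mathscr{C}'$, a version of $\mathbb{P}(B|\mathscr{C})$ is any element of $\mathscr{C}$ with $\mathbb{P}(\mathbb{P}(B|\mathscr{C})C)=\mathbb{P}(BC)$ for all $C\in\mathscr{C}$. Equality "with probability one" of $P,Q\in\mathscr{C}$ means $\mathbb{P}((P-Q)^*(P-Q))=0$. Elements of the commutative algebra $\mathscr{Y}_k$ are identified with complex functions on a finite probability space, so quotients are understood pointwise. *)

theory Defs
  imports Complex_Main "HOL-Library.FuncSet" "Jordan_Normal_Form.Schur_Decomposition"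
begin

section \<open>Matrices: tensor products, exponential, star-algebras\<close>

definition kron :: "complex mat \<Rightarrow> complex mat \<Rightarrow> complex mat" where
  "kron A B = mat (dim_row A * dim_row B) (dim_col A * dim_col B)
     (\<lambda>(i, j). A $$ (i div dim_row B, j div dim_col B) * B $$ (i mod dim_row B, j mod dim_col B))"

text \<open>The exponential series is summed entrywise, which in finite dimension is the same as norm
  convergence. The entries of the matrix powers are those of the matrix product.\<close>

definition mat_exp :: "complex mat \<Rightarrow> complex mat" where
  "mat_exp A = mat (dim_row A) (dim_row A) (\<lambda>(i, j). \<Sum>m. (A ^\<^sub>m m) $$ (i, j) / fact m)"

inductive_set star_alg :: "nat \<Rightarrow> complex mat set \<Rightarrow> complex mat set"
  for n :: nat and S :: "complex mat set" where
  star_alg_one: "1\<^sub>m n \<in> star_alg n S"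
| star_alg_gen: "A \<in> S \<Longrightarrow> A \<in> star_alg n S"
| star_alg_add: "A \<in> star_alg n S \<Longrightarrow> B \<in> star_alg n S \<Longrightarrow> A + B \<in> star_alg n S"
| star_alg_smult: "A \<in> star_alg n S \<Longrightarrow> c \<cdot>\<^sub>m A \<in> star_alg n S"
| star_alg_mult: "A \<in> star_alg n S \<Longrightarrow> B \<in> star_alg n S \<Longrightarrow> A * B \<in> star_alg n S"
| star_alg_adjoint: "A \<in> star_alg n S \<Longrightarrow> mat_adjoint A \<in> star_alg n S"


section \<open>States\<close>

definition linear_functional :: "nat \<Rightarrow> (complex mat \<Rightarrow> complex) \<Rightarrow> bool" where
  "linear_functional n f \<longleftrightarrow>
     (\<forall>A \<in> carrier_mat n n. \<forall>B \<in> carrier_mat n n. f (A + B) = f A + f B) \<and>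
     (\<forall>A \<in> carrier_mat n n. \<forall>c. f (c \<cdot>\<^sub>m A) = c * f A)"

definition is_state :: "nat \<Rightarrow> (complex mat \<Rightarrow> complex) \<Rightarrow> bool" where
  "is_state n f \<longleftrightarrow> linear_functional n f \<and>
     (\<forall>A \<in> carrier_mat n n. f (mat_adjoint A * A) \<in> \<real> \<and> 0 \<le> Re (f (mat_adjoint A * A))) \<and>
     f (1\<^sub>m n) = 1"

definition matrix_unit :: "nat \<Rightarrow> nat \<Rightarrow> nat \<Rightarrow> complex mat" where
  "matrix_unit n i j = mat n n (\<lambda>(r, s). if r = i \<and> s = j then 1 else 0)"

definition block :: "nat \<Rightarrow> nat \<Rightarrow> nat \<Rightarrow> complex mat \<Rightarrow> complex mat" where
  "block m i j Z = mat m m (\<lambda>(r, s). Z $$ (i * m + r, j * m + s))"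

text \<open>Tensor product of a functional on n x n matrices and a functional on m x m matrices: every Z is
  the sum of the tensor products of the matrix units with the corresponding m x m blocks of Z.
  The lemma \<open>tensor_functional_kron\<close> below shows that it is multiplicative on elementary tensors.\<close>

definition tensor_functional ::
    "nat \<Rightarrow> nat \<Rightarrow> (complex mat \<Rightarrow> complex) \<Rightarrow> (complex mat \<Rightarrow> complex) \<Rightarrow> complex mat \<Rightarrow> complex" where
  "tensor_functional n m f g Z =
     (\<Sum>i<n. \<Sum>j<n. f (matrix_unit n i j) * g (block m i j Z))"

lemma linear_functional_expand:
  assumes f: "linear_functional n f" and A: "A \<in> carrier_mat n n"
  shows "f A = (\<Sum>i<n. \<Sum>j<n. A $$ (i, j) * f (matrix_unit n i j))"
proof -
  define R where "R I = mat n n (\<lambda>p. if p \<in> I then A $$ p else 0)" for I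
  have add: "f (B + C) = f B + f C" if "B \<in> carrier_mat n n" "C \<in> carrier_mat n n" for B C
    using f that unfolding linear_functional_def by blast
  have smult: "f (c \<cdot>\<^sub>m B) = c * f B" if "B \<in> carrier_mat n n" for B c
    using f that unfolding linear_functional_def by blast
  have unit: "matrix_unit n i j \<in> carrier_mat n n" for i j
    by (simp add: matrix_unit_def)
  have R: "R I \<in> carrier_mat n n" for I
    by (simp add: R_def)
  have "f (R I) = (\<Sum>p\<in>I. A $$ p * f (matrix_unit n (fst p) (snd p)))" if "finite I" for I
    using that
  proof (induction I rule: finite_induct)
    case empty
    have "R {} = 0 \<cdot>\<^sub>m matrix_unit n 0 0"
      by (rule eq_matI) (auto simp: R_def matrix_unit_def)
    then show ?case
      using smult[OF unit, of 0 0 0] by simp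
  next
    case (insert p I)
    have "R (insert p I) = A $$ p \<cdot>\<^sub>m matrix_unit n (fst p) (snd p) + R I"
      using insert.hyps by (intro eq_matI) (auto simp: R_def matrix_unit_def split: prod.splits)
    then have "f (R (insert p I)) = A $$ p * f (matrix_unit n (fst p) (snd p)) + f (R I)"
      using add smult unit R by simp
    then show ?case
      using insert by simp
  qed
  from this[of "{..<n} \<times> {..<n}"]
  have "f (R ({..<n} \<times> {..<n})) = (\<Sum>i<n. \<Sum>j<n. A $$ (i, j) * f (matrix_unit n i j))"
    by (simp add: sum.cartesian_product case_prod_beta)
  moreover have "R ({..<n} \<times> {..<n}) = A"
    using A by (intro eq_matI) (auto simp: R_def)
  ultimately show ?thesis by simp
qed

lemma tensor_functional_kron:
  assumes f: "linear_functional n f" and g: "linear_functional m g"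
    and A: "A \<in> carrier_mat n n" and B: "B \<in> carrier_mat m m"
  shows "tensor_functional n m f g (kron A B) = f A * g B"
proof -
  have lt: "i * m + r < n * m" if "i < n" "r < m" for i r :: nat
  proof -
    have "i * m + r < Suc i * m" using that by simp
    also have "\<dots> \<le> n * m" using that by (intro mult_le_mono1) simp
    finally show ?thesis .
  qed
  have "g (block m i j (kron A B)) = A $$ (i, j) * g B" if "i < n" "j < n" for i j
  proof -
    have "block m i j (kron A B) = A $$ (i, j) \<cdot>\<^sub>m B"
      using that A B by (intro eq_matI) (auto simp: block_def kron_def lt)
    then show ?thesis
      using g B unfolding linear_functional_def by simp
  qed
  then have "tensor_functional n m f g (kron A B)
      = (\<Sum>i<n. \<Sum>j<n. f (matrix_unit n i j) * (A $$ (i, j) * g B))"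
    unfolding tensor_functional_def by simp
  also have "\<dots> = (\<Sum>i<n. \<Sum>j<n. A $$ (i, j) * f (matrix_unit n i j)) * g B"
    by (simp add: sum_distrib_left mult_ac)
  finally show ?thesis
    using linear_functional_expand[OF f A] by simp
qed


section \<open>Conditional expectation, almost sure equality, quotients\<close>

definition is_cond_exp ::
    "(complex mat \<Rightarrow> complex) \<Rightarrow> complex mat set \<Rightarrow> complex mat \<Rightarrow> complex mat \<Rightarrow> bool" where
  "is_cond_exp P C B E \<longleftrightarrow> E \<in> C \<and> (\<forall>K \<in> C. P (E * K) = P (B * K))"

definition as_eq :: "(complex mat \<Rightarrow> complex) \<Rightarrow> complex mat \<Rightarrow> complex mat \<Rightarrow> bool" where
  "as_eq P A B \<longleftrightarrow> P (mat_adjoint (A - B) * (A - B)) = 0"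

text \<open>A star-isomorphism of a unital star-algebra C of n x n matrices onto the algebra of all
  complex functions on a finite set. Functions are normalised to be extensional, so that
  bijectivity is meaningful.\<close>

definition function_rep ::
    "nat \<Rightarrow> complex mat set \<Rightarrow> 'w set \<Rightarrow> (complex mat \<Rightarrow> 'w \<Rightarrow> complex) \<Rightarrow> bool" where
  "function_rep n C \<Omega> \<iota> \<longleftrightarrow> finite \<Omega> \<and> bij_betw \<iota> C (extensional \<Omega>) \<and>
     (\<forall>w \<in> \<Omega>. \<iota> (1\<^sub>m n) w = 1 \<and>
       (\<forall>A \<in> C. \<iota> (mat_adjoint A) w = cnj (\<iota> A w) \<and>
         (\<forall>c. \<iota> (c \<cdot>\<^sub>m A) w = c * \<iota> A w) \<and>
         (\<forall>B \<in> C. \<iota> (A + B) w = \<iota> A w + \<iota> B w \<and> \<iota> (A * B) w = \<iota> A w * \<iota> B w)))"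

text \<open>R is a pointwise quotient of N by D in the commutative star-algebra C. At the points where
  the denominator vanishes nothing is required of R.\<close>

definition is_quotient ::
    "nat \<Rightarrow> complex mat set \<Rightarrow> complex mat \<Rightarrow> complex mat \<Rightarrow> complex mat \<Rightarrow> bool" where
  "is_quotient n C N D R \<longleftrightarrow> R \<in> C \<and>
     (\<exists>(\<Omega> :: nat set) \<iota>. function_rep n C \<Omega> \<iota> \<and>
        (\<forall>w \<in> \<Omega>. \<iota> D w \<noteq> 0 \<longrightarrow> \<iota> R w = \<iota> N w / \<iota> D w))"


section \<open>The repeated interaction model\<close>

definition sigma_minus :: "complex mat" where
  "sigma_minus = mat_of_rows_list 2 [[0, 0], [1, 0]]"

definition sigma_plus :: "complex mat" where
  "sigma_plus = mat_adjoint sigma_minus"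

definition vac :: "complex vec" where
  "vac = vec_of_list [0, 1]"

text \<open>The library product \<open>x \<bullet>c y\<close> is conjugate linear in y.\<close>

definition vac_state :: "complex mat \<Rightarrow> complex" where
  "vac_state X = (X *\<^sub>v vac) \<bullet>c vac"

primrec vac_states :: "nat \<Rightarrow> complex mat \<Rightarrow> complex" where
  "vac_states 0 Z = Z $$ (0, 0)"
| "vac_states (Suc k) Z = tensor_functional 2 (2 ^ k) vac_state (vac_states k) Z"

definition total_state :: "nat \<Rightarrow> (complex mat \<Rightarrow> complex) \<Rightarrow> complex mat \<Rightarrow> complex" where
  "total_state k \<rho> = tensor_functional 2 (2 ^ k) \<rho> (vac_states k)"

abbreviation dimn :: "nat \<Rightarrow> nat" where
  "dimn k \<equiv> 2 ^ Suc k"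

text \<open>X placed in tensor factor i of the k + 1 factors; factor 0 is the initial system and factor
  i, for i from 1 to k, is the i-th copy in the field algebra.\<close>

definition emb :: "nat \<Rightarrow> nat \<Rightarrow> complex mat \<Rightarrow> complex mat" where
  "emb k i X = kron (1\<^sub>m (2 ^ i)) (kron X (1\<^sub>m (2 ^ (k - i))))"

abbreviation init :: "nat \<Rightarrow> complex mat \<Rightarrow> complex mat" where
  "init k X \<equiv> emb k 0 X"

text \<open>In the following, lam is the square root of T / k.\<close>

definition dA :: "nat \<Rightarrow> real \<Rightarrow> nat \<Rightarrow> complex mat" where
  "dA k lam i = complex_of_real lam \<cdot>\<^sub>m emb k i sigma_minus"

definition dAstar :: "nat \<Rightarrow> real \<Rightarrow> nat \<Rightarrow> complex mat" where
  "dAstar k lam i = complex_of_real lam \<cdot>\<^sub>m emb k i sigma_plus"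

definition dLam :: "nat \<Rightarrow> nat \<Rightarrow> complex mat" where
  "dLam k i = emb k i (sigma_plus * sigma_minus)"

definition dt :: "nat \<Rightarrow> real \<Rightarrow> nat \<Rightarrow> complex mat" where
  "dt k lam i = complex_of_real (lam\<^sup>2) \<cdot>\<^sub>m 1\<^sub>m (dimn k)"

definition Mint ::
    "nat \<Rightarrow> real \<Rightarrow> complex mat \<Rightarrow> complex mat \<Rightarrow> complex mat \<Rightarrow> nat \<Rightarrow> complex mat" where
  "Mint k lam L1 L2 L3 l = mat_exp (- \<i> \<cdot>\<^sub>m
     (init k L1 * dLam k l + init k L2 * dAstar k lam l
       + init k (mat_adjoint L2) * dA k lam l + init k L3 * dt k lam l))"

primrec Uint ::
    "nat \<Rightarrow> real \<Rightarrow> complex mat \<Rightarrow> complex mat \<Rightarrow> complex mat \<Rightarrow> nat \<Rightarrow> complex mat" where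
  "Uint k lam L1 L2 L3 0 = 1\<^sub>m (dimn k)"
| "Uint k lam L1 L2 L3 (Suc l) = Mint k lam L1 L2 L3 (Suc l) * Uint k lam L1 L2 L3 l"

definition jmap ::
    "nat \<Rightarrow> real \<Rightarrow> complex mat \<Rightarrow> complex mat \<Rightarrow> complex mat \<Rightarrow> nat \<Rightarrow> complex mat \<Rightarrow> complex mat" where
  "jmap k lam L1 L2 L3 l X =
     mat_adjoint (Uint k lam L1 L2 L3 l) * init k X * Uint k lam L1 L2 L3 l"

definition dY ::
    "nat \<Rightarrow> real \<Rightarrow> complex mat \<Rightarrow> complex mat \<Rightarrow> complex mat \<Rightarrow> nat \<Rightarrow> complex mat" where
  "dY k lam L1 L2 L3 l =
     mat_adjoint (Uint k lam L1 L2 L3 l) * (dA k lam l + dAstar k lam l) * Uint k lam L1 L2 L3 l"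

definition Yalg ::
    "nat \<Rightarrow> real \<Rightarrow> complex mat \<Rightarrow> complex mat \<Rightarrow> complex mat \<Rightarrow> nat \<Rightarrow> complex mat set" where
  "Yalg k lam L1 L2 L3 l = star_alg (dimn k) (dY k lam L1 L2 L3 ` {1..l})"

definition Lgen :: "real \<Rightarrow> complex mat \<Rightarrow> complex mat \<Rightarrow> complex mat \<Rightarrow> complex mat" where
  "Lgen lam Mp Mo X =
     mat_adjoint Mp * X * Mp + complex_of_real (lam\<^sup>2) \<cdot>\<^sub>m (mat_adjoint Mo * X * Mo)
       + mat_adjoint Mo * X + X * Mo"

definition Jgen :: "real \<Rightarrow> complex mat \<Rightarrow> complex mat \<Rightarrow> complex mat \<Rightarrow> complex mat" where
  "Jgen lam Mp Mo X =
     X * Mp + mat_adjoint Mp * X + complex_of_real (lam\<^sup>2) \<cdot>\<^sub>m (mat_adjoint Mo * X * Mp)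
       + complex_of_real (lam\<^sup>2) \<cdot>\<^sub>m (mat_adjoint Mp * X * Mo)"

end

theory Submission
  imports Defs
begin

text \<open>
  The increments \<open>dY 1, \<dots>, dY k\<close> are commuting self-adjoint involutions up to the scalar
  \<open>lam\<close>, since \<open>dY i = U(l)* (lam \<sigma>\<^sub>x)\<^sub>i U(l)\<close> for every \<open>l \<ge> i\<close>. Hence the algebra they generate is
  spanned by the atoms \<open>\<Prod>\<^sub>i (1 \<plusminus> dY i / lam) / 2\<close>, and on an atom every observable is a scalar.
  The vacuum in factor \<open>l\<close> turns the expectation of \<open>j\<^sub>l(X) C\<close> and of \<open>j\<^sub>l(X) dY(l) C\<close>, for \<open>C\<close> observed
  before time \<open>l\<close>, into those of \<open>j\<^sub>l\<^sub>-\<^sub>1(X + lam\<^sup>2 \<L>(X)) C\<close> and of \<open>lam\<^sup>2 j\<^sub>l\<^sub>-\<^sub>1(\<J>(X)) C\<close>. Splitting an atom at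
  time \<open>l - 1\<close> into its two halves at time \<open>l\<close>, these two numbers determine the filter on both halves
  (Bayes' rule), and the filtering equation becomes an identity between complex numbers.

  Where the denominator vanishes, one of the two halves has probability zero and on the other the
  innovation is zero, so that the value of the quotient is irrelevant there.\<close>

section \<open>Adjoints\<close>

text \<open>The step from time l - 1 to time l rests on causality: everything built before step l
  leaves field factor l alone, so a vacuum projection at that factor can be moved up to the
  interaction unitary of step l from both sides. There sigma_- and sigma_+ sigma_- annihilate the
  vacuum vector, so of the four coefficients only \<open>Mp\<close> and \<open>Mo\<close> survive;
  compressing the identity and sigma_x between what remains produces L and J. The obstacle is that
  neither the filter nor the quotient is a definite object. A version of a conditional expectation
  is determined only up to null elements and need not be linear, and a quotient is known only
  through some unspecified function representation. Hence the scalar of the filter on an atom is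
  always obtained from an expectation by dividing by the nonzero probability of an atom, and the
  quotient R enters only through the identity D (D R) = D N, whose additional factor D absorbs the
  zeros of D. Null events are removed from expectations by the degenerate case of the Cauchy-Schwarz
  inequality, for which positivity of the state suffices.\<close>

lemma mat_adjoint_dim [simp]:
  "dim_row (mat_adjoint A) = dim_col A" "dim_col (mat_adjoint A) = dim_row A"
  by (simp_all add: mat_adjoint_def)

lemma mat_adjoint_index [simp]:
  "i < dim_col A \<Longrightarrow> j < dim_row A \<Longrightarrow> mat_adjoint A $$ (i, j) = conjugate (A $$ (j, i))"
  by (simp add: mat_adjoint_def mat_of_rows_index)

lemma mat_adjoint_carrier [simp]: "A \<in> carrier_mat m n \<Longrightarrow> mat_adjoint A \<in> carrier_mat n m"
  by (rule carrier_matI) auto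

lemma mat_adjoint_adjoint [simp]: "mat_adjoint (mat_adjoint A) = A"
  by (rule eq_matI) auto

lemma mat_adjoint_one [simp]: "mat_adjoint (1\<^sub>m n) = (1\<^sub>m n :: complex mat)"
  by (rule eq_matI) auto

lemma mat_adjoint_add:
  "A \<in> carrier_mat m n \<Longrightarrow> B \<in> carrier_mat m n \<Longrightarrow>
    mat_adjoint (A + B) = mat_adjoint A + mat_adjoint (B :: complex mat)"
  by (rule eq_matI) auto

lemma mat_adjoint_smult: "mat_adjoint (c \<cdot>\<^sub>m A) = cnj c \<cdot>\<^sub>m mat_adjoint A"
  by (rule eq_matI) auto

lemma mat_mult_index_sum:
  "A \<in> carrier_mat m n \<Longrightarrow> B \<in> carrier_mat n p \<Longrightarrow> i < m \<Longrightarrow> j < p \<Longrightarrow>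
    (A * B) $$ (i, j) = (\<Sum>r<n. A $$ (i, r) * B $$ (r, j))"
  by (auto simp: scalar_prod_def atLeast0LessThan)

lemma mat_adjoint_mult:
  "A \<in> carrier_mat m n \<Longrightarrow> B \<in> carrier_mat n p \<Longrightarrow>
    mat_adjoint (A * B) = mat_adjoint B * mat_adjoint (A :: complex mat)"
  by (rule eq_matI)
    (auto simp: mat_mult_index_sum[of _ m n _ p] mat_mult_index_sum[of _ p n _ m] mult.commute
      simp del: index_mult_mat(1))

section \<open>Kronecker products\<close>

lemma kron_carrier [simp]:
  "A \<in> carrier_mat m n \<Longrightarrow> B \<in> carrier_mat p q \<Longrightarrow> kron A B \<in> carrier_mat (m * p) (n * q)"
  by (auto simp: kron_def)

lemma kron_dim [simp]:
  "dim_row (kron A B) = dim_row A * dim_row B" "dim_col (kron A B) = dim_col A * dim_col B"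
  by (simp_all add: kron_def)

lemma kron_index:
  "i < dim_row A * dim_row B \<Longrightarrow> j < dim_col A * dim_col B \<Longrightarrow>
    kron A B $$ (i, j) = A $$ (i div dim_row B, j div dim_col B) * B $$ (i mod dim_row B, j mod dim_col B)"
  by (simp add: kron_def)

text \<open>Row-major reindexing r = a * n + b. It splits the sum over the middle index of a product
  of Kronecker products into two independent sums.\<close>

lemma sum_div_mod:
  fixes f :: "nat \<Rightarrow> nat \<Rightarrow> 'a :: comm_monoid_add"
  shows "(\<Sum>r<m * n. f (r div n) (r mod n)) = (\<Sum>a<m. \<Sum>b<n. f a b)"
proof -
  have "(\<Sum>a<m. \<Sum>b<n. f a b) = (\<Sum>(a, b)\<in>{..<m} \<times> {..<n}. f a b)"
    by (simp add: sum.cartesian_product)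
  also have "\<dots> = (\<Sum>r<m * n. f (r div n) (r mod n))"
  proof (rule sum.reindex_bij_witness[where i = "\<lambda>r. (r div n, r mod n)" and j = "\<lambda>(a, b). a * n + b"])
    fix x assume x: "x \<in> {..<m} \<times> {..<n}"
    then obtain a b where [simp]: "x = (a, b)" and ab: "a < m" "b < n" by auto
    show "((case x of (a, b) \<Rightarrow> a * n + b) div n, (case x of (a, b) \<Rightarrow> a * n + b) mod n) = x"
      using ab by simp
    have "a * n + b < Suc a * n" using ab by simp
    also have "\<dots> \<le> m * n" using ab by (intro mult_le_mono1) simp
    finally show "(case x of (a, b) \<Rightarrow> a * n + b) \<in> {..<m * n}" by simp
    show "f ((case x of (a, b) \<Rightarrow> a * n + b) div n) ((case x of (a, b) \<Rightarrow> a * n + b) mod n)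
        = (case x of (a, b) \<Rightarrow> f a b)"
      using ab by simp
  next
    fix r assume r: "r \<in> {..<m * n}"
    then have "n > 0" by (cases n) auto
    then show "(r div n, r mod n) \<in> {..<m} \<times> {..<n}"
      using r by (auto simp: less_mult_imp_div_less)
  qed auto
  finally show ?thesis by simp
qed

lemma div_mod_less:
  fixes i :: nat
  assumes "i < m * n"
  shows "i div n < m" "i mod n < n"
  using assms by (cases n; auto simp: less_mult_imp_div_less)+

text \<open>The mixed-product rule, from which all later multiplication and commutation rules for
  operators on different tensor factors follow.\<close>

lemma kron_mult:
  assumes A: "A \<in> carrier_mat m n" and B: "B \<in> carrier_mat p q"
    and C: "C \<in> carrier_mat n r" and D: "D \<in> carrier_mat q s"
  shows "kron A B * kron C D = kron (A * C) (B * D)"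
proof (rule eq_matI)
  fix i j assume "i < dim_row (kron (A * C) (B * D))" "j < dim_col (kron (A * C) (B * D))"
  then have i: "i < m * p" and j: "j < r * s" using A B C D by auto
  note ij = div_mod_less[OF i] div_mod_less[OF j]
  have "(kron A B * kron C D) $$ (i, j) = (\<Sum>t<n * q. kron A B $$ (i, t) * kron C D $$ (t, j))"
    using A B C D i j by (intro mat_mult_index_sum) auto
  also have "\<dots> = (\<Sum>t<n * q. (A $$ (i div p, t div q) * B $$ (i mod p, t mod q)) *
      (C $$ (t div q, j div s) * D $$ (t mod q, j mod s)))"
    using A B C D i j by (intro sum.cong) (auto simp: kron_index)
  also have "\<dots> = (\<Sum>a<n. \<Sum>b<q. (A $$ (i div p, a) * B $$ (i mod p, b)) *
      (C $$ (a, j div s) * D $$ (b, j mod s)))"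
    by (rule sum_div_mod)
  also have "\<dots> = (\<Sum>a<n. A $$ (i div p, a) * C $$ (a, j div s)) *
      (\<Sum>b<q. B $$ (i mod p, b) * D $$ (b, j mod s))"
    by (simp add: sum_product mult_ac)
  also have "\<dots> = (A * C) $$ (i div p, j div s) * (B * D) $$ (i mod p, j mod s)"
    using ij by (simp only: mat_mult_index_sum[OF A C] mat_mult_index_sum[OF B D])
  also have "\<dots> = kron (A * C) (B * D) $$ (i, j)"
    using A B C D i j by (simp add: kron_index del: index_mult_mat(1))
  finally show "(kron A B * kron C D) $$ (i, j) = kron (A * C) (B * D) $$ (i, j)" .
qed (use A B C D in auto)

lemma kron_adjoint: "mat_adjoint (kron A B) = kron (mat_adjoint A) (mat_adjoint B)"
  by (rule eq_matI) (auto simp: kron_index div_mod_less)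

lemma kron_one: "kron (1\<^sub>m m) (1\<^sub>m n) = 1\<^sub>m (m * n)"
proof (rule eq_matI)
  fix i j assume "i < dim_row (1\<^sub>m (m * n) :: complex mat)" "j < dim_col (1\<^sub>m (m * n) :: complex mat)"
  then have ij: "i < m * n" "j < m * n" by auto
  have "i = j \<longleftrightarrow> i div n = j div n \<and> i mod n = j mod n" by (metis div_mult_mod_eq)
  then show "kron (1\<^sub>m m) (1\<^sub>m n) $$ (i, j) = 1\<^sub>m (m * n) $$ (i, j)"
    using ij div_mod_less[OF ij(1)] div_mod_less[OF ij(2)] by (auto simp: kron_index)
qed auto

lemma kron_add_left:
  "A \<in> carrier_mat m n \<Longrightarrow> A' \<in> carrier_mat m n \<Longrightarrow> kron (A + A') B = kron A B + kron A' B"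
  by (rule eq_matI) (auto simp: kron_index algebra_simps div_mod_less)

lemma kron_add_right:
  "B \<in> carrier_mat m n \<Longrightarrow> B' \<in> carrier_mat m n \<Longrightarrow> kron A (B + B') = kron A B + kron A B'"
  by (rule eq_matI) (auto simp: kron_index algebra_simps div_mod_less)

lemma kron_smult_left: "kron (c \<cdot>\<^sub>m A) B = c \<cdot>\<^sub>m kron A B"
  by (rule eq_matI) (auto simp: kron_index div_mod_less)

lemma kron_smult_right: "kron A (c \<cdot>\<^sub>m B) = c \<cdot>\<^sub>m kron A B"
  by (rule eq_matI) (auto simp: kron_index div_mod_less)

lemma kron_assoc: "kron (kron A B) C = kron A (kron B C)"
proof (rule eq_matI)
  fix i j assume "i < dim_row (kron A (kron B C))" "j < dim_col (kron A (kron B C))"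
  then have i: "i < dim_row A * (dim_row B * dim_row C)" and j: "j < dim_col A * (dim_col B * dim_col C)"
    by auto
  have i': "i < (dim_row A * dim_row B) * dim_row C" and j': "j < (dim_col A * dim_col B) * dim_col C"
    using i j by (simp_all add: mult.assoc)
  \<comment> \<open>Both sides of the claim pick out the three digits of an index in mixed radix;
    the digit rules are given for either order of the product of the two radices.\<close>
  have *: "x mod (y * z) div z = x div z mod y" "x mod (y * z) mod z = x mod z" 
      "x mod (z * y) div z = x div z mod y" "x mod (z * y) mod z = x mod z" for x y z :: nat
    by (cases "z = 0"; simp add: mod_mult2_eq mult.commute[of y z])+
  show "kron (kron A B) C $$ (i, j) = kron A (kron B C) $$ (i, j)"
    using div_mod_less[OF i] div_mod_less[OF i'] div_mod_less[OF j] div_mod_less[OF j'] i i' j j'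
    by (simp add: kron_index * div_mult2_eq mult.commute[of "dim_row B"] mult.commute[of "dim_col B"] mult.assoc[symmetric])
qed (auto simp: mult.assoc)

section \<open>Embedded operators\<close>

lemma two_pow_split: "i \<le> k \<Longrightarrow> 2 ^ i * (2 * 2 ^ (k - i)) = (2 * 2 ^ k :: nat)"
  by (simp flip: power_add power_Suc)

lemma emb_carrier:
  assumes "X \<in> carrier_mat 2 2" "i \<le> k"
  shows "emb k i X \<in> carrier_mat (dimn k) (dimn k)"
proof -
  have "emb k i X \<in> carrier_mat (2 ^ i * (2 * 2 ^ (k - i))) (2 ^ i * (2 * 2 ^ (k - i)))"
    unfolding emb_def using assms by (intro kron_carrier) auto
  then show ?thesis using assms two_pow_split by simp
qed

lemma emb_one: "i \<le> k \<Longrightarrow> emb k i (1\<^sub>m 2) = 1\<^sub>m (dimn k)"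
  by (simp add: emb_def kron_one two_pow_split)

lemma emb_add:
  "X \<in> carrier_mat 2 2 \<Longrightarrow> Y \<in> carrier_mat 2 2 \<Longrightarrow> emb k i (X + Y) = emb k i X + emb k i Y"
  unfolding emb_def
  by (simp add: kron_add_left[of _ 2 2] kron_add_right[of _ "2 * 2 ^ (k - i)" "2 * 2 ^ (k - i)"])

lemma emb_smult: "emb k i (c \<cdot>\<^sub>m X) = c \<cdot>\<^sub>m emb k i X"
  unfolding emb_def by (simp add: kron_smult_left kron_smult_right)

lemma emb_adjoint: "mat_adjoint (emb k i X) = emb k i (mat_adjoint X)"
  unfolding emb_def by (simp add: kron_adjoint)

lemma emb_mult:
  assumes "X \<in> carrier_mat 2 2" "Y \<in> carrier_mat 2 2"
  shows "emb k i X * emb k i Y = emb k i (X * Y)"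
  unfolding emb_def using assms
  by (simp add: kron_mult[of _ "2 ^ i" "2 ^ i" _ "2 * 2 ^ (k - i)" "2 * 2 ^ (k - i)" _ "2 ^ i" _ "2 * 2 ^ (k - i)"]
      kron_mult[of _ 2 2 _ "2 ^ (k - i)" "2 ^ (k - i)" _ 2 _ "2 ^ (k - i)"])

text \<open>Over the splitting into the factors before i, factor i and the factors after i, one
  operator is 1 (x) X (x) 1 and the other 1 (x) 1 (x) B. By the mixed-product rule both products are
  1 (x) X (x) B.\<close>

lemma emb_commute_less:
  assumes X: "X \<in> carrier_mat 2 2" and Y: "Y \<in> carrier_mat 2 2" and ij: "i < j" "j \<le> k"
  shows "emb k i X * emb k j Y = emb k j Y * emb k i X"
proof -
  define m n p where "m = (2 ^ i :: nat)" and "n = (2 ^ (j - Suc i) :: nat)" and "p = (2 ^ (k - j) :: nat)"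
  obtain a where a: "j = Suc (i + a)" using less_imp_Suc_add[OF ij(1)] by blast
  obtain b where b: "k = Suc (i + a + b)" using le_Suc_ex[OF ij(2)] a by auto
  note ab = a b
  have j: "2 ^ j = m * (2 * n)" and k: "2 ^ (k - i) = n * (2 * p)"
    by (simp_all add: m_def n_def p_def ab power_add)
  define q B where "q = n * (2 * p)" and "B = kron (1\<^sub>m n) (kron Y (1\<^sub>m p))"
  have B: "B \<in> carrier_mat q q"
    using Y unfolding q_def B_def by (intro kron_carrier) auto
  have "emb k i X = kron (1\<^sub>m m) (kron X (1\<^sub>m q))"
    by (simp add: emb_def k q_def flip: m_def)
  moreover have "emb k j Y = kron (1\<^sub>m m) (kron (1\<^sub>m 2) B)"
    by (simp add: emb_def j B_def flip: p_def kron_one) (simp add: kron_assoc)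
  ultimately show ?thesis
    using X B by (simp add: kron_mult[of _ m m _ "2 * q" "2 * q" _ m _ "2 * q"]
        kron_mult[of _ 2 2 _ q q _ 2 _ q])
qed

lemma emb_commute:
  assumes "X \<in> carrier_mat 2 2" "Y \<in> carrier_mat 2 2" "i \<noteq> j" "i \<le> k" "j \<le> k"
  shows "emb k i X * emb k j Y = emb k j Y * emb k i X"
  using assms emb_commute_less[of X Y i j k] emb_commute_less[of Y X j i k]
  by (metis linorder_neqE_nat)

section \<open>The matrix exponential\<close>

lemma pow_mat_carrier' [simp]: "A \<in> carrier_mat n n \<Longrightarrow> A ^\<^sub>m m \<in> carrier_mat n n"
  by (rule pow_carrier_mat)

lemma pow_mat_add:
  "A \<in> carrier_mat n n \<Longrightarrow> A ^\<^sub>m i * A ^\<^sub>m j = A ^\<^sub>m (i + j)"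
proof (induction j)
  case (Suc j)
  have "A ^\<^sub>m i * A ^\<^sub>m Suc j = (A ^\<^sub>m i * A ^\<^sub>m j) * A"
    using Suc.prems by (simp add: assoc_mult_mat[of _ n n _ n _ n])
  then show ?case using Suc by simp
qed (simp add: right_mult_one_mat[of _ n n])

lemma smult_smult_mat: "a \<cdot>\<^sub>m (b \<cdot>\<^sub>m A) = (a * b) \<cdot>\<^sub>m A" for a :: "'a :: semigroup_mult"
  by (rule eq_matI) (auto simp: mult.assoc)

lemma pow_mat_smult:
  "A \<in> carrier_mat n n \<Longrightarrow> (c \<cdot>\<^sub>m A) ^\<^sub>m m = c ^ m \<cdot>\<^sub>m (A ^\<^sub>m m :: complex mat)"
proof (induction m)
  case (Suc m)
  then show ?case
    by (simp add: mult_smult_distrib[of _ n n _ n] mult_smult_assoc_mat[of _ n n _ n]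
        smult_smult_mat mult.commute)
qed auto

lemma pow_mat_adjoint:
  "A \<in> carrier_mat n n \<Longrightarrow> mat_adjoint (A ^\<^sub>m m) = mat_adjoint A ^\<^sub>m m" for A :: "complex mat"
proof (induction m)
  case (Suc m)
  have "mat_adjoint (A ^\<^sub>m Suc m) = mat_adjoint A ^\<^sub>m 1 * mat_adjoint A ^\<^sub>m m"
    using Suc by (simp add: mat_adjoint_mult[of _ n n _ n] left_mult_one_mat[of _ n n])
  then show ?case
    using Suc.prems by (simp only: pow_mat_add[of "mat_adjoint A" n] mat_adjoint_carrier plus_1_eq_Suc)
qed simp

text \<open>With c the sum of the moduli of all entries of A, one further factor A enlarges an entry
  bound by at most the factor c. Geometric growth is then dominated by the scalar exponential
  series.\<close>

lemma pow_mat_entry_bound: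
  fixes A :: "complex mat"
  assumes A: "A \<in> carrier_mat n n"
  obtains c where "\<And>m i j. i < n \<Longrightarrow> j < n \<Longrightarrow> norm ((A ^\<^sub>m m) $$ (i, j)) \<le> c ^ m"
proof
  let ?c = "\<Sum>j<n. \<Sum>r<n. norm (A $$ (r, j))"
  show "norm ((A ^\<^sub>m m) $$ (i, j)) \<le> ?c ^ m" if "i < n" "j < n" for m i j
    using that
  proof (induction m arbitrary: j)
    case (Suc m)
    have "norm ((A ^\<^sub>m Suc m) $$ (i, j)) = norm (\<Sum>r<n. (A ^\<^sub>m m) $$ (i, r) * A $$ (r, j))"
      using A Suc.prems by (simp add: mat_mult_index_sum[of _ n n _ n] del: index_mult_mat(1))
    also have "\<dots> \<le> (\<Sum>r<n. ?c ^ m * norm (A $$ (r, j)))"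
      using Suc by (intro sum_norm_le) (auto simp: norm_mult intro!: mult_right_mono)
    also have "\<dots> = ?c ^ m * (\<Sum>r<n. norm (A $$ (r, j)))"
      by (simp add: sum_distrib_left)
    also have "\<dots> \<le> ?c ^ m * ?c"
      using Suc.prems
      by (intro mult_left_mono member_le_sum[of j] zero_le_power sum_nonneg) auto
    finally show ?case by (simp add: mult.commute)
  qed (use A in auto)
qed

lemma mat_exp_summable:
  fixes A :: "complex mat"
  assumes A: "A \<in> carrier_mat n n" and ij: "i < n" "j < n"
  shows "summable (\<lambda>m. norm ((A ^\<^sub>m m) $$ (i, j) / fact m))"
proof -
  obtain c where c: "\<And>m i j. i < n \<Longrightarrow> j < n \<Longrightarrow> norm ((A ^\<^sub>m m) $$ (i, j)) \<le> c ^ m"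
    using pow_mat_entry_bound[OF A] by blast
  show ?thesis
    by (rule summable_comparison_test'[OF summable_exp[of c]])
      (use c ij in \<open>simp add: norm_divide divide_right_mono field_simps\<close>)
qed

lemma mat_exp_carrier [simp]: "A \<in> carrier_mat n n \<Longrightarrow> mat_exp A \<in> carrier_mat n n"
  by (auto simp: mat_exp_def)

lemma mat_exp_index:
  "A \<in> carrier_mat n n \<Longrightarrow> i < n \<Longrightarrow> j < n \<Longrightarrow>
    mat_exp A $$ (i, j) = (\<Sum>m. (A ^\<^sub>m m) $$ (i, j) / fact m)"
  by (simp add: mat_exp_def)

lemma mat_exp_adjoint:
  assumes A: "A \<in> carrier_mat n n"
  shows "mat_adjoint (mat_exp A) = mat_exp (mat_adjoint A)"
proof (rule eq_matI)
  fix i j assume "i < dim_row (mat_exp (mat_adjoint A))" "j < dim_col (mat_exp (mat_adjoint A))"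
  then have ij: "i < n" "j < n" using A by (simp_all add: mat_exp_def)
  have "mat_exp A $$ (j, i) = (\<Sum>m. (A ^\<^sub>m m) $$ (j, i) / fact m)"
    using A ij by (simp add: mat_exp_index)
  then have "(\<lambda>m. (A ^\<^sub>m m) $$ (j, i) / fact m) sums (mat_exp A $$ (j, i))"
    using summable_norm_cancel[OF mat_exp_summable[OF A ij(2,1)]] by (simp add: summable_sums)
  then have "(\<lambda>m. cnj ((A ^\<^sub>m m) $$ (j, i) / fact m)) sums cnj (mat_exp A $$ (j, i))"
    by (simp only: sums_cnj)
  moreover have "cnj ((A ^\<^sub>m m) $$ (j, i) / fact m) = (mat_adjoint A ^\<^sub>m m) $$ (i, j) / fact m" for m
    using A ij by (simp flip: pow_mat_adjoint)
  ultimately show "mat_adjoint (mat_exp A) $$ (i, j) = mat_exp (mat_adjoint A) $$ (i, j)"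
    using A ij by (simp add: mat_exp_index[of _ n] sums_iff mat_exp_def)
qed (use A in \<open>simp_all add: mat_exp_def\<close>)

text \<open>The Cauchy product of the entry series has m-th term (1 - 1)^m times the entry of A^m /
  m!, by the binomial theorem; only m = 0 contributes.\<close>

lemma mat_exp_mult_uminus:
  fixes A :: "complex mat"
  assumes A: "A \<in> carrier_mat n n"
  shows "mat_exp A * mat_exp ((-1) \<cdot>\<^sub>m A) = 1\<^sub>m n"
proof (rule eq_matI)
  fix i j assume "i < dim_row (1\<^sub>m n :: complex mat)" "j < dim_col (1\<^sub>m n :: complex mat)"
  then have ij: "i < n" "j < n" by simp_all
  let ?B = "(-1) \<cdot>\<^sub>m A"
  have B: "?B \<in> carrier_mat n n" using A by simp
  define a b where "a r m = (A ^\<^sub>m m) $$ (i, r) / fact m"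
    and "b r m = (?B ^\<^sub>m m) $$ (r, j) / fact m" for r m
  have "(\<lambda>m. \<Sum>r<n. \<Sum>p\<le>m. a r p * b r (m - p)) sums (\<Sum>r<n. (\<Sum>m. a r m) * (\<Sum>m. b r m))"
    using mat_exp_summable[OF A ij(1)] mat_exp_summable[OF B _ ij(2)]
    unfolding a_def b_def by (intro sums_sum Cauchy_product_sums) auto
  moreover have "(\<Sum>r<n. (\<Sum>m. a r m) * (\<Sum>m. b r m)) = (mat_exp A * mat_exp ?B) $$ (i, j)"
    using A B ij
    by (simp add: mat_mult_index_sum[of _ n n _ n] mat_exp_index[of _ n] a_def b_def
        del: index_mult_mat(1))
  moreover have "(\<Sum>r<n. \<Sum>p\<le>m. a r p * b r (m - p)) = (if m = 0 then (1\<^sub>m n) $$ (i, j) else 0)" for m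
  proof -
    have "(\<Sum>r<n. \<Sum>p\<le>m. a r p * b r (m - p)) = (\<Sum>p\<le>m. \<Sum>r<n. a r p * b r (m - p))"
      by (rule sum.swap)
    \<comment> \<open>The factor \<open>1 ^ p\<close> brings the sum into the shape of the binomial
      expansion of (1 + (-1))^m.\<close>
    also have "\<dots> = (\<Sum>p\<le>m. of_nat (m choose p) * 1 ^ p * (-1) ^ (m - p) * ((A ^\<^sub>m m) $$ (i, j) / fact m))"
    proof (rule sum.cong[OF refl])
      fix p assume p: "p \<in> {..m}"
      have "(\<Sum>r<n. a r p * b r (m - p))
          = (-1) ^ (m - p) * (\<Sum>r<n. (A ^\<^sub>m p) $$ (i, r) * (A ^\<^sub>m (m - p)) $$ (r, j)) / (fact p * fact (m - p))"
        using A ij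
        by (simp add: a_def b_def pow_mat_smult[OF A] sum_divide_distrib sum_distrib_left mult_ac
            carrier_matD[OF pow_mat_carrier'[OF A]])
      also have "(\<Sum>r<n. (A ^\<^sub>m p) $$ (i, r) * (A ^\<^sub>m (m - p)) $$ (r, j)) = (A ^\<^sub>m p * A ^\<^sub>m (m - p)) $$ (i, j)"
        using A ij by (simp only: mat_mult_index_sum[of _ n n _ n] pow_mat_carrier')
      also have "A ^\<^sub>m p * A ^\<^sub>m (m - p) = A ^\<^sub>m m"
        using p by (simp add: pow_mat_add[OF A])
      finally show "(\<Sum>r<n. a r p * b r (m - p))
          = of_nat (m choose p) * 1 ^ p * (-1) ^ (m - p) * ((A ^\<^sub>m m) $$ (i, j) / fact m)"
        using p by (simp add: binomial_fact)
    qed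
    also have "\<dots> = (1 + (-1)) ^ m * ((A ^\<^sub>m m) $$ (i, j) / fact m)"
      by (simp only: binomial_ring sum_distrib_right)
    also have "\<dots> = (if m = 0 then (1\<^sub>m n) $$ (i, j) else 0)"
      using A ij by (simp add: power_0_left)
    finally show ?thesis .
  qed
  ultimately have "(\<lambda>m. if m = 0 then (1\<^sub>m n) $$ (i, j) else 0) sums (mat_exp A * mat_exp ?B) $$ (i, j)"
    by simp
  then show "(mat_exp A * mat_exp ?B) $$ (i, j) = (1\<^sub>m n) $$ (i, j)"
    using sums_single[of 0 "\<lambda>_. (1\<^sub>m n) $$ (i, j) :: complex"] sums_unique2 by blast
qed (use A in \<open>simp_all add: mat_exp_def\<close>)

lemma mat_exp_unitary:
  assumes A: "A \<in> carrier_mat n n" and skew: "mat_adjoint A = (-1) \<cdot>\<^sub>m A"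
  shows "mat_adjoint (mat_exp A) * mat_exp A = 1\<^sub>m n" "mat_exp A * mat_adjoint (mat_exp A) = 1\<^sub>m n"
proof -
  show "mat_exp A * mat_adjoint (mat_exp A) = 1\<^sub>m n"
    using mat_exp_mult_uminus[OF A] by (simp add: mat_exp_adjoint[OF A] skew)
  have "(-1) \<cdot>\<^sub>m ((-1) \<cdot>\<^sub>m A) = A"
    by (rule eq_matI) auto
  then show "mat_adjoint (mat_exp A) * mat_exp A = 1\<^sub>m n"
    using mat_exp_mult_uminus[of "(-1) \<cdot>\<^sub>m A" n] A by (simp add: mat_exp_adjoint[OF A] skew)
qed

section \<open>States\<close>

lemma mat_adjoint_carrier_sq: "A \<in> carrier_mat n n \<Longrightarrow> mat_adjoint A \<in> carrier_mat n n"
  by simp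

text \<open>The matrix laws carry size premises; with all sizes equal to one n these can be
  discharged automatically.\<close>

lemmas sq_carrier = mult_carrier_mat[of _ n n _ n] add_carrier_mat[of _ n n] smult_carrier_mat[of _ n n]
  mat_adjoint_carrier_sq[of _ n] one_carrier_mat[of n] for n

lemmas sq_linear = sq_carrier add_mult_distrib_mat[of _ n n _ _ n] mult_add_distrib_mat[of _ n n _ n]
  mult_smult_distrib[of _ n n _ n] mult_smult_assoc_mat[of _ n n _ n] assoc_mult_mat[of _ n n _ n _ n]
  for n

lemmas sq_adjoint = mat_adjoint_add[of _ n n] mat_adjoint_mult[of _ n n _ n]
  for n

lemma state_add:
  "is_state n P \<Longrightarrow> A \<in> carrier_mat n n \<Longrightarrow> B \<in> carrier_mat n n \<Longrightarrow> P (A + B) = P A + P B"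
  by (simp add: is_state_def linear_functional_def)

lemma state_smult: "is_state n P \<Longrightarrow> A \<in> carrier_mat n n \<Longrightarrow> P (c \<cdot>\<^sub>m A) = c * P A"
  by (simp add: is_state_def linear_functional_def)

lemma state_positive:
  "is_state n P \<Longrightarrow> A \<in> carrier_mat n n \<Longrightarrow>
    P (mat_adjoint A * A) \<in> \<real> \<and> 0 \<le> Re (P (mat_adjoint A * A))"
  by (simp add: is_state_def)

text \<open>Reality at t = 1 and t = i forces v to be the conjugate of u. The expression is then
  affine in t over the reals, and an affine function bounded below is constant.\<close>

lemma complex_quadratic_form_zero:
  fixes u v c :: complex
  assumes "\<And>t. t * u + cnj t * v + c \<in> \<real> \<and> 0 \<le> Re (t * u + cnj t * v + c)"
  shows "u = 0" "v = 0"
proof -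
  have c: "Im c = 0" using assms[of 0] by (simp add: complex_is_Real_iff)
  have "Im u + Im v = 0" using assms[of 1] c by (simp add: complex_is_Real_iff)
  moreover have "Re u = Re v" using assms[of \<i>] c by (simp add: complex_is_Real_iff)
  ultimately have v: "v = cnj u" by (simp add: complex_eq_iff)
  define r where "r = (Re u)\<^sup>2 + (Im u)\<^sup>2"
  \<comment> \<open>The direction t = - s cnj u makes the linear part equal to - 2 s |u|^2.\<close>
  have *: "0 \<le> Re c - 2 * s * r" for s :: real
    using assms[of "- of_real s * cnj u"]
    by (simp add: v r_def power2_eq_square algebra_simps)
  have "r = 0"
  proof (rule ccontr)
    assume "r \<noteq> 0"
    \<comment> \<open>This s would make the lower bound equal to -1.\<close>
    then show False using *[of "(Re c + 1) / (2 * r)"] by simp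
  qed
  then show "u = 0" by (simp add: r_def complex_eq_iff sum_power2_eq_zero_iff)
  then show "v = 0" by (simp add: v)
qed

text \<open>The degenerate case of Cauchy-Schwarz: in the expansion of P on the square of t A + B^*
  the term in |t|^2 is P (A^* A) = 0, so nonnegativity for all t kills the terms linear in t and cnj
  t.\<close>

lemma state_null_left_right:
  assumes P: "is_state n P" and A: "A \<in> carrier_mat n n" and B: "B \<in> carrier_mat n n"
    and null: "P (mat_adjoint A * A) = 0"
  shows "P (B * A) = 0" "P (mat_adjoint A * B) = 0"
proof -
  have "t * P (B * A) + cnj t * P (mat_adjoint A * mat_adjoint B) + P (B * mat_adjoint B)
      = P (mat_adjoint (t \<cdot>\<^sub>m A + mat_adjoint B) * (t \<cdot>\<^sub>m A + mat_adjoint B))"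
    if B: "B \<in> carrier_mat n n" for t B
    using A B null
    by (simp add: sq_linear[where n = n] sq_adjoint[where n = n] mat_adjoint_smult
        state_add[OF P] state_smult[OF P] algebra_simps del: assoc_mult_mat)
  then have *: "t * P (B * A) + cnj t * P (mat_adjoint A * mat_adjoint B) + P (B * mat_adjoint B) \<in> \<real> \<and>
     0 \<le> Re (t * P (B * A) + cnj t * P (mat_adjoint A * mat_adjoint B) + P (B * mat_adjoint B))"
    if "B \<in> carrier_mat n n" for t B
    using state_positive[OF P, of "t \<cdot>\<^sub>m A + mat_adjoint B"] A that by simp
  show "P (B * A) = 0"
    using complex_quadratic_form_zero(1)[OF *[OF B]] .
  show "P (mat_adjoint A * B) = 0"
    using complex_quadratic_form_zero(2)[OF *[of "mat_adjoint B"]] B by simp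
qed

section \<open>The vacuum\<close>

lemma vac_state_matrix_unit:
  "i < 2 \<Longrightarrow> j < 2 \<Longrightarrow> vac_state (matrix_unit 2 i j) = (if i = 1 \<and> j = 1 then 1 else 0)"
  by (auto simp: vac_state_def vac_def matrix_unit_def scalar_prod_def numeral_2_eq_2
      atLeast0_lessThan_Suc less_Suc_eq)

lemma lessThan_2_nat: "{..<2 :: nat} = {0, 1}"
  by auto

text \<open>The vacuum vector is the second basis vector, so the product vacuum is the last basis
  vector and its state reads off the last diagonal entry.\<close>

lemma vac_states_eq: "vac_states k Z = Z $$ (2 ^ k - 1, 2 ^ k - 1)"
proof (induction k arbitrary: Z)
  case (Suc k)
  have "vac_states (Suc k) Z = vac_states k (block (2 ^ k) 1 1 Z)"
    by (simp add: tensor_functional_def vac_state_matrix_unit lessThan_2_nat del: One_nat_def)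
  also have "\<dots> = Z $$ (2 ^ Suc k - 1, 2 ^ Suc k - 1)"
    by (simp add: Suc block_def mult_2)
  finally show ?case .
qed simp

text \<open>The position of the basis vector e_i (x) vacuum^k: binary digit i for the initial
  system, followed by k ones.\<close>

definition vac_index :: "nat \<Rightarrow> nat \<Rightarrow> nat" where
  "vac_index k i = i * 2 ^ k + (2 ^ k - 1)"

text \<open>This is V^* Z V for the isometry V that tensors a vector of the initial system with the
  product vacuum. The total state is \<open>\<rho>\<close> after this compression.\<close>

definition vac_compress :: "nat \<Rightarrow> complex mat \<Rightarrow> complex mat" where
  "vac_compress k Z = mat 2 2 (\<lambda>(i, j). Z $$ (vac_index k i, vac_index k j))"

lemma total_state_eq:
  assumes \<rho>: "linear_functional 2 \<rho>"
  shows "total_state k \<rho> Z = \<rho> (vac_compress k Z)"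
proof -
  have "vac_compress k Z \<in> carrier_mat 2 2" by (simp add: vac_compress_def)
  from linear_functional_expand[OF \<rho> this] show ?thesis
    by (simp add: total_state_def tensor_functional_def vac_states_eq block_def vac_compress_def vac_index_def mult.commute)
qed

lemma vac_index_less: "i < 2 \<Longrightarrow> vac_index k i < 2 * 2 ^ k"
proof -
  assume "i < 2"
  then have "i * 2 ^ k \<le> 1 * 2 ^ k" by (intro mult_le_mono1) simp
  then show ?thesis
    using zero_less_power[of "2 :: nat" k] unfolding vac_index_def by linarith
qed

lemma vac_index_eq_iff: "vac_index k i = vac_index k j \<longleftrightarrow> i = j"
  unfolding vac_index_def add_right_cancel by simp

lemma total_state_is_state:
  assumes \<rho>: "is_state 2 \<rho>"
  shows "is_state (dimn k) (total_state k \<rho>)"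
proof -
  have lin: "linear_functional 2 \<rho>" using \<rho> by (simp add: is_state_def)
  let ?n = "dimn k" and ?m = "vac_index k"
  have V: "vac_compress k Z \<in> carrier_mat 2 2" for Z by (simp add: vac_compress_def)
  have "vac_compress k (A + B) = vac_compress k A + vac_compress k B"
    if "A \<in> carrier_mat ?n ?n" "B \<in> carrier_mat ?n ?n" for A B
    using that by (intro eq_matI) (auto simp: vac_compress_def vac_index_less)
  moreover have "vac_compress k (c \<cdot>\<^sub>m A) = c \<cdot>\<^sub>m vac_compress k A"
    if "A \<in> carrier_mat ?n ?n" for c A
    using that by (intro eq_matI) (auto simp: vac_compress_def vac_index_less)
  moreover have "vac_compress k (1\<^sub>m ?n) = 1\<^sub>m 2"
  proof (rule eq_matI)
    fix i j assume "i < dim_row (1\<^sub>m 2 :: complex mat)" "j < dim_col (1\<^sub>m 2 :: complex mat)"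
    then show "vac_compress k (1\<^sub>m ?n) $$ (i, j) = 1\<^sub>m 2 $$ (i, j)"
      using vac_index_less[of i k] vac_index_less[of j k] by (auto simp: vac_compress_def vac_index_eq_iff)
  qed (auto simp: vac_compress_def)
  moreover have "\<rho> (vac_compress k (mat_adjoint A * A)) \<in> \<real> \<and>
      0 \<le> Re (\<rho> (vac_compress k (mat_adjoint A * A)))"
    if A: "A \<in> carrier_mat ?n ?n" for A
  proof -
    \<comment> \<open>Positivity of \<open>\<rho>\<close> is available only on squares of 2 x 2
      matrices, so the compression of A^* A is written as a sum of such squares. \<open>G r\<close>
      holds row r of A, restricted to the two vacuum columns, as its first row; its second row is
      zero.\<close>
    define G where "G r = mat 2 2 (\<lambda>(i, j). if i = 0 then A $$ (r, ?m j) else 0)" for r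
    have G: "G r \<in> carrier_mat 2 2" for r by (simp add: G_def)
    have entry: "vac_compress k (mat_adjoint A * A) $$ (i, j) = (\<Sum>r<?n. (mat_adjoint (G r) * G r) $$ (i, j))"
      if ij: "i < 2" "j < 2" for i j
    proof -
      have "(mat_adjoint (G r) * G r) $$ (i, j) = cnj (A $$ (r, ?m i)) * A $$ (r, ?m j)" for r
        using ij G[of r]
        by (simp add: mat_mult_index_sum[of _ 2 2 _ 2] G_def lessThan_2_nat del: index_mult_mat(1))
      then show ?thesis
        using ij A
        by (simp add: vac_compress_def mat_mult_index_sum[of _ ?n ?n _ ?n] vac_index_less del: index_mult_mat(1))
    qed
    have "\<rho> (vac_compress k (mat_adjoint A * A))
        = (\<Sum>i<2. \<Sum>j<2. (\<Sum>r<?n. (mat_adjoint (G r) * G r) $$ (i, j)) * \<rho> (matrix_unit 2 i j))"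
      using linear_functional_expand[OF lin V, of "mat_adjoint A * A"] entry by simp
    also have "\<dots> = (\<Sum>r<?n. \<Sum>i<2. \<Sum>j<2. (mat_adjoint (G r) * G r) $$ (i, j) * \<rho> (matrix_unit 2 i j))"
      by (simp add: lessThan_2_nat sum_distrib_right sum.distrib del: index_mult_mat(1))
    also have "\<dots> = (\<Sum>r<?n. \<rho> (mat_adjoint (G r) * G r))"
      using linear_functional_expand[OF lin mult_carrier_mat[OF mat_adjoint_carrier[OF G] G]] by simp
    finally show ?thesis
      using state_positive[OF \<rho> G] by (auto intro!: sum_in_Reals sum_nonneg)
  qed
  moreover have "\<rho> (1\<^sub>m 2) = 1" using \<rho> by (simp add: is_state_def)
  ultimately show ?thesis
    unfolding is_state_def linear_functional_def total_state_eq[OF lin]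
    using \<rho> V by (auto simp: state_add state_smult)
qed

lemma sigma_carrier [simp]:
  "sigma_minus \<in> carrier_mat 2 2" "sigma_plus \<in> carrier_mat 2 2"
  by (auto simp: sigma_minus_def sigma_plus_def mat_of_rows_list_def)

text \<open>Every field digit of a vacuum position is 1, so an operator at field factor l
  contributes its vacuum expectation, the entry (1, 1), and the initial system is untouched.\<close>

lemma vac_compress_emb:
  assumes l: "1 \<le> l" "l \<le> k" and X: "X \<in> carrier_mat 2 2"
  shows "vac_compress k (emb k l X) = X $$ (1, 1) \<cdot>\<^sub>m 1\<^sub>m 2"
proof (rule eq_matI)
  fix i j assume "i < dim_row (X $$ (1, 1) \<cdot>\<^sub>m 1\<^sub>m 2)" "j < dim_col (X $$ (1, 1) \<cdot>\<^sub>m 1\<^sub>m 2)"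
  then have ij: "i < 2" "j < 2" by auto
  define s q where "s = (2 ^ (l - 1) :: nat)" and "q = (2 ^ (k - l) :: nat)"
  have "l = Suc (l - 1)" "k = (l - 1) + Suc (k - l)" using l by simp_all
  then have s: "2 ^ l = 2 * s" and k: "2 ^ k = s * (2 * q)"
    unfolding s_def q_def by (metis power_Suc, metis power_add power_Suc)
  have pos: "s > 0" "q > 0" by (simp_all add: s_def q_def)
  define a where "a = vac_index k"
  have a: "a i = (i * s + (s - 1)) * (2 * q) + (2 * q - 1)" for i
  proof -
    have "s * (2 * q) - 1 = (s - 1) * (2 * q) + (2 * q - 1)"
      using pos by (cases s) (simp_all add: algebra_simps)
    then show ?thesis by (simp add: a_def vac_index_def k algebra_simps)
  qed
  \<comment> \<open>Division by 2 q keeps the digits before factor l. The remainder q + (q - 1)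
    consists of digit 1 at factor l and ones behind it.\<close>
  have div_mod: "a i div (2 * q) = i * s + (s - 1)" "a i mod (2 * q) = q + (q - 1)" for i
  proof -
    have "a i div (2 * q) = (i * s + (s - 1)) + (2 * q - 1) div (2 * q)"
      unfolding a using pos by (intro div_mult_self3) simp
    moreover have "a i mod (2 * q) = (2 * q - 1) mod (2 * q)"
      unfolding a by (rule mod_mult_self3)
    ultimately show "a i div (2 * q) = i * s + (s - 1)" "a i mod (2 * q) = q + (q - 1)"
      using pos by simp_all
  qed
  have a_less: "a i < (2 * s) * (2 * q)" if "i < 2" for i
    using vac_index_less[OF that, of k] by (simp add: a_def k mult_ac)
  have "(q + (q - 1)) div q = 1 + (q - 1) div q" "(q + (q - 1)) mod q = (q - 1) mod q"
    using pos by (simp_all only: div_add_self1 mod_add_self1)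
  then have q: "(q + (q - 1)) div q = 1" "(q + (q - 1)) mod q = q - 1" "q + (q - 1) < 2 * q"
    using pos by simp_all
  have "emb k l X $$ (a i, a j) = (1\<^sub>m (2 * s)) $$ (a i div (2 * q), a j div (2 * q)) *
      kron X (1\<^sub>m q) $$ (a i mod (2 * q), a j mod (2 * q))"
    using a_less ij X unfolding emb_def s q_def[symmetric] by (subst kron_index) auto
  also have "kron X (1\<^sub>m q) $$ (a i mod (2 * q), a j mod (2 * q)) = X $$ (1, 1)"
    using q X pos unfolding div_mod by (subst kron_index) auto
  also have "(1\<^sub>m (2 * s)) $$ (a i div (2 * q), a j div (2 * q)) * X $$ (1, 1)
      = (1\<^sub>m (2 * s)) $$ (i * s + (s - 1), j * s + (s - 1)) * X $$ (1, 1)"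
    by (simp only: div_mod)
  also have "\<dots> = (X $$ (1, 1) \<cdot>\<^sub>m 1\<^sub>m 2) $$ (i, j)"
    using ij pos by (auto simp: less_2_cases_iff split: if_splits)
  finally show "vac_compress k (emb k l X) $$ (i, j) = (X $$ (1, 1) \<cdot>\<^sub>m 1\<^sub>m 2) $$ (i, j)"
    using ij by (simp add: vac_compress_def a_def)
qed (auto simp: vac_compress_def)

section \<open>Eigenvectors among matrices\<close>

text \<open>A matrix takes the place of an eigenvector, so that an observable can be a scalar on a
  projection. If Z = 0, every c qualifies; uniqueness therefore asks for Z to be nonzero.\<close>

definition eig :: "complex mat \<Rightarrow> complex mat \<Rightarrow> complex \<Rightarrow> bool" where
  "eig A Z c \<longleftrightarrow> A * Z = c \<cdot>\<^sub>m Z"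

lemma one_smult_mat: "1 \<cdot>\<^sub>m A = (A :: 'a :: monoid_mult mat)"
  by (rule eq_matI) auto

lemma eig_one: "Z \<in> carrier_mat n n \<Longrightarrow> eig (1\<^sub>m n) Z 1"
  unfolding eig_def by (intro eq_matI) auto

lemma eig_add:
  assumes "A \<in> carrier_mat n n" "B \<in> carrier_mat n n" "Z \<in> carrier_mat n n" "eig A Z a" "eig B Z b"
  shows "eig (A + B) Z (a + b)"
  using assms unfolding eig_def
  by (simp add: add_mult_distrib_mat[of _ n n _ _ n] add_smult_distrib_right_mat[of _ n n])

lemma eig_smult:
  assumes "A \<in> carrier_mat n n" "Z \<in> carrier_mat n n" "eig A Z a"
  shows "eig (c \<cdot>\<^sub>m A) Z (c * a)"
  using assms unfolding eig_def by (simp add: mult_smult_assoc_mat[of _ n n _ n] smult_smult_mat)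

lemma mat_minus_eq_add_smult:
  "A \<in> carrier_mat n n \<Longrightarrow> B \<in> carrier_mat n n \<Longrightarrow> A - B = A + (-1) \<cdot>\<^sub>m (B :: complex mat)"
  by (rule eq_matI) auto

lemma eig_minus:
  assumes "A \<in> carrier_mat n n" "B \<in> carrier_mat n n" "Z \<in> carrier_mat n n" "eig A Z a" "eig B Z b"
  shows "eig (A - B) Z (a - b)"
  using eig_add[of A n "(-1) \<cdot>\<^sub>m B" Z a "(-1) * b"] eig_smult[of B n Z b "-1"] assms
  by (simp add: mat_minus_eq_add_smult[of _ n])

lemma eig_mult:
  assumes "A \<in> carrier_mat n n" "B \<in> carrier_mat n n" "Z \<in> carrier_mat n n" "eig A Z a" "eig B Z b"
  shows "eig (A * B) Z (a * b)"
  using assms unfolding eig_def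
  by (simp add: assoc_mult_mat[of _ n n _ n _ n] mult_smult_distrib[of _ n n _ n] smult_smult_mat mult.commute)

lemma eig_unique:
  assumes "Z \<in> carrier_mat n n" "Z \<noteq> 0\<^sub>m n n" "eig A Z a" "eig A Z b"
  shows "a = b"
proof (rule ccontr)
  assume "a \<noteq> b"
  have eq: "a \<cdot>\<^sub>m Z = b \<cdot>\<^sub>m Z" using assms(3,4) by (simp add: eig_def)
  have "Z = 0\<^sub>m n n"
  proof (rule eq_matI)
    fix i j assume ij: "i < dim_row (0\<^sub>m n n :: complex mat)" "j < dim_col (0\<^sub>m n n :: complex mat)"
    have "(a \<cdot>\<^sub>m Z) $$ (i, j) = (b \<cdot>\<^sub>m Z) $$ (i, j)" by (simp only: eq)
    then show "Z $$ (i, j) = 0\<^sub>m n n $$ (i, j)" using assms(1) ij \<open>a \<noteq> b\<close> by simp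
  qed (use assms(1) in auto)
  then show False using assms(2) by blast
qed

section \<open>Star-algebras\<close>

lemma star_alg_carrier:
  assumes "S \<subseteq> carrier_mat n n"
  shows "A \<in> star_alg n S \<Longrightarrow> A \<in> carrier_mat n n"
  by (induction rule: star_alg.induct) (use assms in auto)

lemma star_alg_mono: "A \<in> star_alg n S \<Longrightarrow> S \<subseteq> S' \<Longrightarrow> A \<in> star_alg n S'"
  by (induction rule: star_alg.induct) (auto intro: star_alg.intros)

lemma star_alg_minus:
  assumes "S \<subseteq> carrier_mat n n" "A \<in> star_alg n S" "B \<in> star_alg n S"
  shows "A - B \<in> star_alg n S"
  using assms star_alg_carrier[OF assms(1)]
  by (simp add: mat_minus_eq_add_smult[of _ n] star_alg.intros)

lemma mult_commute_left:
  assumes "A \<in> carrier_mat n n" "B \<in> carrier_mat n n" "C \<in> carrier_mat n n"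
    and "A * C = C * A" "B * C = C * B"
  shows "(A * B) * C = C * (A * B)"
proof -
  have "(A * B) * C = A * (B * C)" using assms(1-3) by (rule assoc_mult_mat)
  also have "\<dots> = A * (C * B)" by (simp only: assms)
  also have "\<dots> = (A * C) * B" using assms(1,3,2) by (rule assoc_mult_mat[symmetric])
  also have "\<dots> = (C * A) * B" by (simp only: assms)
  also have "\<dots> = C * (A * B)" using assms(3,1,2) by (rule assoc_mult_mat)
  finally show ?thesis .
qed

text \<open>Commutation of the adjoint is carried along in the induction, because the adjoint step
  exchanges the two claims.\<close>

lemma star_alg_commute:
  assumes S: "S \<subseteq> carrier_mat n n" and B: "B \<in> carrier_mat n n"
    and comm: "\<And>A. A \<in> S \<Longrightarrow> A * B = B * A" "\<And>A. A \<in> S \<Longrightarrow> mat_adjoint A * B = B * mat_adjoint A"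
  shows "A \<in> star_alg n S \<Longrightarrow> A * B = B * A \<and> mat_adjoint A * B = B * mat_adjoint A"
proof (induction rule: star_alg.induct)
  case (star_alg_mult A C)
  have AC: "A \<in> carrier_mat n n" "C \<in> carrier_mat n n"
    using star_alg_mult.hyps star_alg_carrier[OF S] by auto
  then show ?case
    using star_alg_mult.IH mult_commute_left[of A n C B] B
      mult_commute_left[of "mat_adjoint C" n "mat_adjoint A" B]
    by (auto simp: mat_adjoint_mult[of _ n n _ n])
next
  case (star_alg_add A C)
  then have "A \<in> carrier_mat n n" "C \<in> carrier_mat n n" using star_alg_carrier[OF S] by auto
  then show ?case
    using star_alg_add.IH B
    by (simp add: mat_adjoint_add[of _ n n] add_mult_distrib_mat[of _ n n _ _ n] mult_add_distrib_mat[of _ n n _ n])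
next
  case (star_alg_smult A c)
  then have "A \<in> carrier_mat n n" using star_alg_carrier[OF S] by auto
  then show ?case
    using star_alg_smult.IH B
    by (simp add: mat_adjoint_smult mult_smult_distrib[of _ n n _ n] mult_smult_assoc_mat[of _ n n _ n])
qed (use comm B in auto)

text \<open>This turns a quotient, known only through an unspecified representation by functions,
  into an identity between matrices.\<close>

lemma quotient_mult:
  assumes S: "S \<subseteq> carrier_mat n n" and Q: "is_quotient n (star_alg n S) N D R"
    and N: "N \<in> star_alg n S" and D: "D \<in> star_alg n S"
  shows "D * (D * R) = D * N"
proof -
  obtain \<Omega> :: "nat set" and \<iota> where rep: "function_rep n (star_alg n S) \<Omega> \<iota>"
    and quot: "\<And>w. w \<in> \<Omega> \<Longrightarrow> \<iota> D w \<noteq> 0 \<Longrightarrow> \<iota> R w = \<iota> N w / \<iota> D w"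
    using Q unfolding is_quotient_def by blast
  have R: "R \<in> star_alg n S" using Q by (simp add: is_quotient_def)
  have mult: "\<iota> (A * B) w = \<iota> A w * \<iota> B w" if "A \<in> star_alg n S" "B \<in> star_alg n S" "w \<in> \<Omega>" for A B w
    using rep that unfolding function_rep_def by blast
  have DR: "D * (D * R) \<in> star_alg n S" and DN: "D * N \<in> star_alg n S"
    using D R N by (auto intro: star_alg.intros)
  \<comment> \<open>Where D vanishes, both sides are zero whatever the value of R; this is the
    purpose of the leading D on both sides.\<close>
  have "\<iota> (D * (D * R)) w = \<iota> (D * N) w" if "w \<in> \<Omega>" for w
    using quot[OF that] that D R N by (cases "\<iota> D w = 0") (simp_all add: mult star_alg.intros)
  moreover have bij: "bij_betw \<iota> (star_alg n S) (extensional \<Omega>)"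
    using rep by (simp add: function_rep_def)
  ultimately have "\<iota> (D * (D * R)) = \<iota> (D * N)"
    using bij_betw_apply[OF bij DR] bij_betw_apply[OF bij DN] by (intro extensionalityI[of _ \<Omega>]) auto
  then show ?thesis
    using bij DR DN by (auto simp: bij_betw_def inj_on_def)
qed

section \<open>The algebra generated by commuting involutions\<close>

locale commuting_involutions =
  fixes n k :: nat and lam :: real and x :: "nat \<Rightarrow> complex mat"
  assumes lam: "lam \<noteq> 0"
    and x_carrier: "i \<in> {1..k} \<Longrightarrow> x i \<in> carrier_mat n n"
    and x_adjoint: "i \<in> {1..k} \<Longrightarrow> mat_adjoint (x i) = x i"
    and x_square: "i \<in> {1..k} \<Longrightarrow> x i * x i = of_real (lam\<^sup>2) \<cdot>\<^sub>m 1\<^sub>m n"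
    and x_commute: "i \<in> {1..k} \<Longrightarrow> j \<in> {1..k} \<Longrightarrow> x i * x j = x j * x i"
begin

abbreviation Y :: "nat \<Rightarrow> complex mat set" where
  "Y j \<equiv> star_alg n (x ` {1..j})"

definition sg :: "bool \<Rightarrow> complex" where
  "sg b = (if b then 1 else -1)"

text \<open>The spectral projection of \<open>x j\<close> for the eigenvalue
  \<open>sg b * lam\<close>.\<close>

definition h :: "bool \<Rightarrow> nat \<Rightarrow> complex mat" where
  "h b j = (1 / 2) \<cdot>\<^sub>m 1\<^sub>m n + (sg b / (2 * of_real lam)) \<cdot>\<^sub>m x j"

text \<open>The joint spectral projection of the first j observations. Signs are counted from 0 and
  observations from 1, so \<open>s j\<close> is the sign of \<open>x (Suc j)\<close>. An atom may be
  the zero matrix.\<close>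

primrec atom :: "(nat \<Rightarrow> bool) \<Rightarrow> nat \<Rightarrow> complex mat" where
  "atom s 0 = 1\<^sub>m n"
| "atom s (Suc j) = atom s j * h (s j) (Suc j)"

lemma gen_subset: "j \<le> k \<Longrightarrow> x ` {1..j} \<subseteq> carrier_mat n n"
  using x_carrier by auto

lemma Y_carrier: "j \<le> k \<Longrightarrow> A \<in> Y j \<Longrightarrow> A \<in> carrier_mat n n"
  by (rule star_alg_carrier[OF gen_subset])

lemma Y_mono: "i \<le> j \<Longrightarrow> A \<in> Y i \<Longrightarrow> A \<in> Y j"
  by (rule star_alg_mono[of _ _ "x ` {1..i}"]) auto

text \<open>\<open>star_alg_commute\<close> is applied twice: to pass from the generators to B with
  one generator fixed, and then from the generators to A with B fixed.\<close>

lemma Y_commute: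
  assumes A: "A \<in> Y k" and B: "B \<in> Y k"
  shows "A * B = B * A"
proof -
  have "x i * B = B * x i" if i: "i \<in> {1..k}" for i
  proof -
    have "B * x i = x i * B \<and> mat_adjoint B * x i = x i * mat_adjoint B"
      using x_commute x_adjoint i by (intro star_alg_commute[OF gen_subset x_carrier[OF i] _ _ B]) auto
    then show ?thesis by simp
  qed
  then have "A * B = B * A \<and> mat_adjoint A * B = B * mat_adjoint A"
    using x_adjoint by (intro star_alg_commute[OF gen_subset Y_carrier[OF _ B] _ _ A]) auto
  then show ?thesis by simp
qed

lemma h_in_Y: "i \<in> {1..j} \<Longrightarrow> h b i \<in> Y j"
  unfolding h_def by (intro star_alg_add star_alg_smult star_alg_one star_alg_gen imageI)

lemma atom_in_Y: "atom s j \<in> Y j"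
proof (induction j)
  case (Suc j)
  have "atom s j \<in> Y (Suc j)" using Suc Y_mono[of j "Suc j"] by simp
  then show ?case using h_in_Y[of "Suc j" "Suc j"] by (simp add: star_alg_mult)
qed (simp add: star_alg_one)

lemma h_carrier: "i \<in> {1..k} \<Longrightarrow> h b i \<in> carrier_mat n n"
  using Y_carrier[of k] h_in_Y by auto

lemma atom_carrier: "j \<le> k \<Longrightarrow> atom s j \<in> carrier_mat n n"
  using Y_carrier atom_in_Y by auto

lemma x_h: "i \<in> {1..k} \<Longrightarrow> eig (x i) (h b i) (sg b * of_real lam)"
  using x_carrier[of i] lam unfolding eig_def h_def
  by (auto simp: mult_add_distrib_mat[of _ n n _ n] mult_smult_distrib[of _ n n _ n] x_square
      smult_smult_mat add_smult_distrib_left_mat[of _ n n] right_mult_one_mat[of _ n n] sg_def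
      comm_add_mat[of _ n n] power2_eq_square)

lemma x_atom: "j \<le> k \<Longrightarrow> i < j \<Longrightarrow> eig (x (Suc i)) (atom s j) (sg (s i) * of_real lam)"
proof (induction j)
  case (Suc j)
  have car: "x (Suc i) \<in> carrier_mat n n" "atom s j \<in> carrier_mat n n" "h (s j) (Suc j) \<in> carrier_mat n n"
    using Suc.prems x_carrier atom_carrier h_carrier by auto
  show ?case
  proof (cases "i = j")
    case True
    have "x (Suc i) * atom s j = atom s j * x (Suc i)"
      using Suc.prems by (intro Y_commute Y_mono[OF _ atom_in_Y] star_alg_gen) auto
    then have "x (Suc i) * (atom s j * h (s j) (Suc j)) = atom s j * (x (Suc i) * h (s j) (Suc j))"
      using assoc_mult_mat[OF car] assoc_mult_mat[OF car(2,1,3)] by metis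
    then show ?thesis
      using x_h[of "Suc i" "s i"] Suc.prems car True by (simp add: eig_def mult_smult_distrib[of _ n n _ n])
  next
    case False
    then show ?thesis
      using Suc car unfolding eig_def
      by (simp add: mult_smult_assoc_mat[of _ n n _ n] flip: assoc_mult_mat[of _ n n _ n _ n])
  qed
qed simp

lemma h_atom:
  assumes "j \<le> k" "i < j"
  shows "eig (h b (Suc i)) (atom s j) (if b = s i then 1 else 0)"
proof -
  have "eig (h b (Suc i)) (atom s j) (1 / 2 * 1 + sg b / (2 * of_real lam) * (sg (s i) * of_real lam))"
    unfolding h_def using assms x_carrier[of "Suc i"] atom_carrier
    by (intro eig_add[of _ n] eig_smult[of _ n] eig_one x_atom) auto
  moreover have "1 / 2 * 1 + sg b / (2 * of_real lam) * (sg (s i) * of_real lam) = (if b = s i then 1 else 0)"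
    using lam by (auto simp: sg_def)
  ultimately show ?thesis by simp
qed

text \<open>Atoms of two times are compared at once, since idempotence, orthogonality and refinement
  are all instances.\<close>

lemma atom_atom:
  assumes "i \<le> j" "j \<le> k"
  shows "eig (atom s i) (atom t j) (if \<forall>r<i. s r = t r then 1 else 0)"
  using assms(1)
proof (induction i)
  case 0
  then show ?case using eig_one[OF atom_carrier[OF assms(2)]] by simp
next
  case (Suc i)
  have *: "eig (atom s (Suc i)) (atom t j)
      ((if \<forall>r<i. s r = t r then 1 else 0) * (if s i = t i then 1 else 0))"
    unfolding atom.simps using Suc assms(2)
    by (intro eig_mult[of _ n] h_atom atom_carrier h_carrier Suc.IH) auto
  have eq: "(if \<forall>r<i. s r = t r then 1 else 0) * (if s i = t i then 1 else 0)
      = (if \<forall>r<Suc i. s r = t r then 1 else 0 :: complex)"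
    by (auto simp: less_Suc_eq)
  show ?case using * unfolding eq .
qed

lemma atom_idem: "i \<le> j \<Longrightarrow> j \<le> k \<Longrightarrow> atom s i * atom s j = atom s j"
  using atom_atom[of i j s s] by (simp add: eig_def one_smult_mat)

lemma h_adjoint: "i \<in> {1..k} \<Longrightarrow> mat_adjoint (h b i) = h b i"
  using x_carrier by (simp add: h_def mat_adjoint_add[of _ n n] mat_adjoint_smult x_adjoint sg_def)

lemma atom_adjoint: "j \<le> k \<Longrightarrow> mat_adjoint (atom s j) = atom s j"
proof (induction j)
  case (Suc j)
  then have "mat_adjoint (atom s (Suc j)) = h (s j) (Suc j) * atom s j"
    by (simp add: mat_adjoint_mult[OF atom_carrier h_carrier] h_adjoint)
  also have "\<dots> = atom s j * h (s j) (Suc j)"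
    using Suc.prems by (intro Y_commute Y_mono[OF _ atom_in_Y] h_in_Y) auto
  finally show ?case by simp
qed simp

text \<open>The adjoint is the only case that needs more than calculation with eigenvalues: with Z
  the self-adjoint atom, A^* Z = (Z A)^* = (A Z)^*, which uses that A commutes with Z.\<close>

lemma Y_atom:
  assumes j: "j \<le> k" and A: "A \<in> Y j"
  shows "\<exists>c. eig A (atom s j) c"
  using A
proof (induction rule: star_alg.induct)
  case star_alg_one
  then show ?case using eig_one[OF atom_carrier[OF j]] by blast
next
  case (star_alg_gen A)
  then obtain i where "A = x (Suc i)" "i < j" by (metis Suc_le_eq atLeastAtMost_iff imageE not0_implies_Suc not_one_le_zero)
  then show ?case using x_atom[OF j] by blast
next
  case (star_alg_add A B)
  then show ?case using eig_add[OF Y_carrier[OF j] Y_carrier[OF j] atom_carrier[OF j]] by blast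
next
  case (star_alg_smult A c)
  then show ?case using eig_smult[OF Y_carrier[OF j] atom_carrier[OF j]] by blast
next
  case (star_alg_mult A B)
  then show ?case using eig_mult[OF Y_carrier[OF j] Y_carrier[OF j] atom_carrier[OF j]] by blast
next
  case (star_alg_adjoint A)
  then obtain c where c: "A * atom s j = c \<cdot>\<^sub>m atom s j" unfolding eig_def by blast
  have A: "A \<in> carrier_mat n n" using Y_carrier[OF j] star_alg_adjoint by blast
  have "mat_adjoint A * atom s j = mat_adjoint (atom s j * A)"
    using A j by (simp add: mat_adjoint_mult[OF atom_carrier A] atom_adjoint)
  also have "atom s j * A = A * atom s j"
    using j star_alg_adjoint by (intro Y_commute Y_mono[of j k] atom_in_Y) auto
  also have "mat_adjoint \<dots> = cnj c \<cdot>\<^sub>m atom s j"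
    using j by (simp add: c mat_adjoint_smult atom_adjoint)
  finally show ?case unfolding eig_def by blast
qed

text \<open>A later atom is absorbed by the earlier one with the same signs, so scalars found at
  time i remain valid on the final atoms.\<close>

lemma eig_atom_mono:
  assumes "i \<le> j" "j \<le> k" "A \<in> carrier_mat n n" "eig A (atom s i) c"
  shows "eig A (atom s j) c"
proof -
  have "A * atom s j = A * (atom s i * atom s j)" using atom_idem assms by simp
  also have "\<dots> = (A * atom s i) * atom s j"
    using assms by (intro assoc_mult_mat[symmetric, of _ n n _ n _ n] atom_carrier) auto
  also have "\<dots> = c \<cdot>\<^sub>m (atom s i * atom s j)"
    using assms atom_carrier by (simp add: eig_def mult_smult_assoc_mat[of _ n n _ n])
  finally show ?thesis using atom_idem assms by (simp add: eig_def)
qed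

lemma atom_cong: "(\<And>i. i < j \<Longrightarrow> s i = t i) \<Longrightarrow> atom s j = atom t j"
  by (induction j) auto

lemma atom_split:
  assumes "j < k"
  shows "atom s j = atom (s(j := True)) (Suc j) + atom (s(j := False)) (Suc j)"
proof -
  have "h True (Suc j) + h False (Suc j) = 1\<^sub>m n"
    using assms x_carrier[of "Suc j"] by (intro eq_matI) (auto simp: h_def sg_def)
  moreover have "atom (s(j := b)) j = atom s j" for b by (rule atom_cong) simp
  ultimately show ?thesis
    using assms atom_carrier[of j s] h_carrier[of "Suc j"]
    by (simp add: right_mult_one_mat[of _ n n] flip: mult_add_distrib_mat[of _ n n _ n])
qed

text \<open>The resolution of the identity into atoms, as an induction principle for additive
  properties. It serves both for equality of matrices and for the vanishing of an
  expectation.\<close>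

lemma one_by_atoms:
  assumes atom: "\<And>s. \<phi> (atom s k)"
    and add: "\<And>A B. A \<in> carrier_mat n n \<Longrightarrow> B \<in> carrier_mat n n \<Longrightarrow> \<phi> A \<Longrightarrow> \<phi> B \<Longrightarrow> \<phi> (A + B)"
  shows "\<phi> (1\<^sub>m n)"
proof -
  \<comment> \<open>The induction runs backwards in time, each atom being the sum of its two halves,
    and ends at time 0, where the atom is the identity.\<close>
  have "\<phi> (atom s (k - i))" if "i \<le> k" for s i
    using that
  proof (induction i arbitrary: s)
    case (Suc i)
    then have "Suc (k - Suc i) = k - i" by simp
    then have "atom s (k - Suc i) = atom (s(k - Suc i := True)) (k - i) + atom (s(k - Suc i := False)) (k - i)"
      using atom_split[of "k - Suc i" s] Suc.prems by simp
    then show ?case using Suc add atom_carrier by simp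
  qed (use atom in simp)
  from this[of k] show ?thesis by simp
qed

lemma eq_by_atoms:
  assumes A: "A \<in> carrier_mat n n" and B: "B \<in> carrier_mat n n"
    and eq: "\<And>s. A * atom s k = B * atom s k"
  shows "A = B"
proof -
  have "A * 1\<^sub>m n = B * 1\<^sub>m n"
    using A B eq by (intro one_by_atoms[of "\<lambda>Z. A * Z = B * Z"]) (simp_all add: mult_add_distrib_mat[of _ n n _ n])
  then show ?thesis using A B by (simp add: right_mult_one_mat[of _ n n])
qed

section \<open>Observables as functions on the nonzero atoms\<close>

lemma atom_as_bit: "\<exists>w :: nat. w < 2 ^ k \<and> atom s k = atom (bit w) k"
proof (intro exI conjI)
  \<comment> \<open>Sign patterns are coded as binary numbers because \<open>is_quotient\<close>
    asks for points that are natural numbers.\<close>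
  let ?w = "horner_sum of_bool 2 (map s [0..<k]) :: nat"
  show "?w < 2 ^ k" using horner_sum_of_bool_2_less[of "map s [0..<k]"] by simp
  show "atom s k = atom (bit ?w) k"
    by (rule atom_cong) (simp add: bit_horner_sum_bit_iff)
qed

text \<open>Zero atoms are left out: no eigenvalue is determined there, and distinct functions would
  otherwise represent the same matrix.\<close>

definition points :: "nat set" where
  "points = {w. w < 2 ^ k \<and> atom (bit w) k \<noteq> 0\<^sub>m n n}"

definition val :: "complex mat \<Rightarrow> nat \<Rightarrow> complex" where
  "val A = restrict (\<lambda>w. THE c. eig A (atom (bit w) k) c) points"

lemma val_eqI:
  assumes "w \<in> points" "eig A (atom (bit w) k) c"
  shows "val A w = c"
  using assms eig_unique[OF atom_carrier[of k]] unfolding val_def points_def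
  by (auto intro!: the_equality)

lemma eig_val: "w \<in> points \<Longrightarrow> A \<in> Y k \<Longrightarrow> eig A (atom (bit w) k) (val A w)"
  using Y_atom[of k A "bit w"] val_eqI by auto

text \<open>The witness is the sum of \<open>g w\<close> times the atom of w over all w < m, built
  up one atom at a time.\<close>

lemma exists_with_values:
  "\<exists>A \<in> Y k. \<forall>w :: nat. w < 2 ^ k \<longrightarrow> eig A (atom (bit w) k) (if w < m then g w else 0)" if "m \<le> 2 ^ k"
  using that
proof (induction m)
  case 0
  have "eig (0 \<cdot>\<^sub>m 1\<^sub>m n) (atom (bit w) k) (0 * 1)" for w
    by (intro eig_smult[of _ n] eig_one atom_carrier) auto
  then show ?case by (intro bexI[of _ "0 \<cdot>\<^sub>m 1\<^sub>m n"]) (auto intro: star_alg.intros)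
next
  case (Suc m)
  then obtain A where A: "A \<in> Y k" "\<And>w :: nat. w < 2 ^ k \<Longrightarrow> eig A (atom (bit w) k) (if w < m then g w else 0)"
    by auto
  have "eig (A + g m \<cdot>\<^sub>m atom (bit m) k) (atom (bit w) k) (if w < Suc m then g w else 0)" if w: "w < 2 ^ k" for w
  proof -
    \<comment> \<open>Both numbers are below 2^k, so agreement of the first k bits is equality; this
      makes distinct atoms orthogonal.\<close>
    have "(\<forall>r<k. bit m r = bit w r) \<longleftrightarrow> take_bit k m = take_bit k w"
      by (auto simp: bit_eq_iff bit_take_bit_iff)
    then have iff: "(\<forall>r<k. bit m r = bit w r) \<longleftrightarrow> m = w"
      using w Suc.prems by (simp add: take_bit_nat_eq_self)
    have "eig (A + g m \<cdot>\<^sub>m atom (bit m) k) (atom (bit w) k)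
        ((if w < m then g w else 0) + g m * (if \<forall>r<k. bit m r = bit w r then 1 else 0))"
      using A w Y_carrier[of k] by (intro eig_add[of _ n] eig_smult[of _ n] atom_atom smult_carrier_mat atom_carrier) auto
    then show ?thesis unfolding iff by (auto simp: less_Suc_eq split: if_splits)
  qed
  then show ?case
    using A atom_in_Y
    by (intro bexI[of _ "A + g m \<cdot>\<^sub>m atom (bit m) k"] star_alg_add star_alg_smult) blast+
qed

text \<open>An explicit Gelfand representation. An observable is determined by its scalars on the
  nonzero atoms, and all scalars occur by \<open>exists_with_values\<close>.\<close>

lemma function_rep_val: "function_rep n (Y k) points val"
proof -
  have "inj_on val (Y k)"
  proof (rule inj_onI)
    fix A B assume A: "A \<in> Y k" and B: "B \<in> Y k" and eq: "val A = val B"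
    have "A * atom s k = B * atom s k" for s
    proof -
      obtain w :: nat where w: "w < 2 ^ k" "atom s k = atom (bit w) k" using atom_as_bit by blast
      show ?thesis
      proof (cases "w \<in> points")
        case True
        then show ?thesis using eig_val[of w A] eig_val[of w B] A B eq w by (simp add: eig_def)
      next
        case False
        then have "atom s k = 0\<^sub>m n n" using w by (simp add: points_def)
        then show ?thesis using Y_carrier[of k] A B by (simp add: right_mult_zero_mat[of _ n n])
      qed
    qed
    then show "A = B" using eq_by_atoms Y_carrier[of k] A B by auto
  qed
  moreover have "val ` Y k = extensional points"
  proof (intro equalityI subsetI)
    fix g :: "nat \<Rightarrow> complex" assume g: "g \<in> extensional points"
    obtain A where A: "A \<in> Y k" "\<And>w :: nat. w < 2 ^ k \<Longrightarrow> eig A (atom (bit w) k) (g w)"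
      using exists_with_values[of "2 ^ k" g] by auto
    have "val A = g"
    proof (rule extensionalityI[of _ points])
      fix w assume w: "w \<in> points"
      then have "w < 2 ^ k" by (simp add: points_def)
      then show "val A w = g w" using val_eqI[OF w] A by simp
    qed (use g in \<open>auto simp: val_def\<close>)
    then show "g \<in> val ` Y k" using A by blast
  qed (auto simp: val_def)
  moreover have "finite points" by (rule finite_subset[of _ "{..<2 ^ k}"]) (auto simp: points_def)
  moreover have "val (1\<^sub>m n) w = 1" if "w \<in> points" for w
    using val_eqI[OF that] eig_one[OF atom_carrier] by simp
  moreover have "val (c \<cdot>\<^sub>m A) w = c * val A w" if "w \<in> points" "A \<in> Y k" for c A w
    using that by (intro val_eqI eig_smult[where n = n, OF _ _ eig_val] Y_carrier[of k] atom_carrier) auto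
  moreover have "val (A + B) w = val A w + val B w" if "w \<in> points" "A \<in> Y k" "B \<in> Y k" for A B w
    using that by (intro val_eqI eig_add[where n = n, OF _ _ _ eig_val eig_val] Y_carrier[of k] atom_carrier) auto
  moreover have "val (A * B) w = val A w * val B w" if "w \<in> points" "A \<in> Y k" "B \<in> Y k" for A B w
    using that by (intro val_eqI eig_mult[where n = n, OF _ _ _ eig_val eig_val] Y_carrier[of k] atom_carrier) auto
  moreover have "val (mat_adjoint A) w = cnj (val A w)" if w: "w \<in> points" and A: "A \<in> Y k" for A w
  proof (rule val_eqI[OF w])
    let ?Z = "atom (bit w) k"
    have Ac: "A \<in> carrier_mat n n" using Y_carrier[of k] A by simp
    have "mat_adjoint A * ?Z = mat_adjoint (?Z * A)"
      by (simp add: mat_adjoint_mult[OF atom_carrier Ac] atom_adjoint)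
    also have "?Z * A = val A w \<cdot>\<^sub>m ?Z"
      using eig_val[OF w A] Y_commute[OF atom_in_Y A] by (simp add: eig_def)
    finally show "eig (mat_adjoint A) ?Z (cnj (val A w))"
      by (simp add: eig_def mat_adjoint_smult atom_adjoint)
  qed
  ultimately show ?thesis by (simp add: function_rep_def bij_betw_def)
qed

lemma quotient_exists: "\<exists>R. is_quotient n (Y k) N D R"
proof -
  \<comment> \<open>At zeros of D the division yields the default value 0, an admissible choice
    there.\<close>
  have "restrict (\<lambda>w. val N w / val D w) points \<in> val ` Y k"
    using function_rep_val by (simp add: function_rep_def bij_betw_def)
  then obtain R where R: "R \<in> Y k" "val R = restrict (\<lambda>w. val N w / val D w) points" by auto
  then show ?thesis
    unfolding is_quotient_def using function_rep_val
    by (intro exI[of _ R] conjI exI[of _ points] exI[of _ val]) simp_all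
qed

end

section \<open>Spin matrices\<close>

lemma mat_2_eqI:
  assumes "A \<in> carrier_mat 2 2" "B \<in> carrier_mat 2 2"
    "A $$ (0, 0) = B $$ (0, 0)" "A $$ (0, 1) = B $$ (0, 1)"
    "A $$ (1, 0) = B $$ (1, 0)" "A $$ (1, 1) = B $$ (1, 1)"
  shows "A = B"
  using assms by (intro eq_matI) (auto simp: less_2_cases_iff)

lemma mat_2_mult_index:
  "A \<in> carrier_mat 2 2 \<Longrightarrow> B \<in> carrier_mat 2 2 \<Longrightarrow> i < 2 \<Longrightarrow> j < 2 \<Longrightarrow>
    (A * B) $$ (i, j) = A $$ (i, 0) * B $$ (0, j) + A $$ (i, 1) * B $$ (1, j)"
  by (simp add: mat_mult_index_sum[of _ 2 2 _ 2] lessThan_2_nat del: index_mult_mat(1))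

lemma spin_dim [simp]:
  "dim_row sigma_minus = 2" "dim_col sigma_minus = 2" "dim_row sigma_plus = 2" "dim_col sigma_plus = 2"
  using sigma_carrier by (blast dest: carrier_matD)+

lemma sigma_index:
  "sigma_minus $$ (0, 0) = 0" "sigma_minus $$ (0, 1) = 0"
  "sigma_minus $$ (1, 0) = 1" "sigma_minus $$ (1, 1) = 0"
  "sigma_plus $$ (0, 0) = 0" "sigma_plus $$ (0, 1) = 1"
  "sigma_plus $$ (1, 0) = 0" "sigma_plus $$ (1, 1) = 0"
proof -
  show *: "sigma_minus $$ (0, 0) = 0" "sigma_minus $$ (0, 1) = 0"
    "sigma_minus $$ (1, 0) = 1" "sigma_minus $$ (1, 1) = 0"
    by (simp_all add: sigma_minus_def mat_of_rows_list_def)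
  show "sigma_plus $$ (0, 0) = 0" "sigma_plus $$ (0, 1) = 1"
    "sigma_plus $$ (1, 0) = 0" "sigma_plus $$ (1, 1) = 0"
    unfolding sigma_plus_def using * by (subst mat_adjoint_index; simp)+
qed

lemmas sigma_index_simps [simp] = sigma_index sigma_index[unfolded One_nat_def]

text \<open>The projection onto the vacuum vector, complementary to sigma_+ sigma_-.\<close>

definition proj_vac :: "complex mat" where
  "proj_vac = sigma_minus * sigma_plus"

definition sigma_x :: "real \<Rightarrow> complex mat" where
  "sigma_x lam = of_real lam \<cdot>\<^sub>m sigma_minus + of_real lam \<cdot>\<^sub>m sigma_plus"

lemma spin_carrier [simp]:
  "proj_vac \<in> carrier_mat 2 2" "sigma_x lam \<in> carrier_mat 2 2"
  "sigma_plus * sigma_minus \<in> carrier_mat 2 2"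
  by (auto simp: proj_vac_def sigma_x_def intro!: mult_carrier_mat[of _ 2 2])

lemma spin_adjoint:
  "mat_adjoint sigma_minus = sigma_plus" "mat_adjoint sigma_plus = sigma_minus"
  "mat_adjoint proj_vac = proj_vac" "mat_adjoint (sigma_x lam) = sigma_x lam"
  "mat_adjoint (sigma_plus * sigma_minus) = sigma_plus * sigma_minus"
proof -
  show 1: "mat_adjoint sigma_minus = sigma_plus" "mat_adjoint sigma_plus = sigma_minus"
    by (simp_all add: sigma_plus_def)
  show "mat_adjoint proj_vac = proj_vac" "mat_adjoint (sigma_plus * sigma_minus) = sigma_plus * sigma_minus"
    by (simp_all add: proj_vac_def mat_adjoint_mult[of _ 2 2 _ 2] 1)
  show "mat_adjoint (sigma_x lam) = sigma_x lam"
    by (simp add: sigma_x_def mat_adjoint_add[of _ 2 2] mat_adjoint_smult 1 comm_add_mat[of _ 2 2])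
qed

text \<open>The zero products say that sigma_- and sigma_+ sigma_- annihilate the vacuum. The last
  four lines are the vacuum matrix elements of the measured quadrature.\<close>

lemma spin_mult:
  "sigma_minus * proj_vac = 0\<^sub>m 2 2" "sigma_plus * proj_vac = sigma_plus"
  "(sigma_plus * sigma_minus) * proj_vac = 0\<^sub>m 2 2"
  "proj_vac * proj_vac = proj_vac" "sigma_plus * sigma_minus + proj_vac = 1\<^sub>m 2"
  "(sigma_plus * sigma_minus) * (sigma_plus * sigma_minus) = sigma_plus * sigma_minus"
  "proj_vac * sigma_plus = 0\<^sub>m 2 2"
  "sigma_x lam * sigma_x lam = of_real (lam\<^sup>2) \<cdot>\<^sub>m 1\<^sub>m 2"
  "proj_vac * (sigma_x lam * proj_vac) = 0\<^sub>m 2 2"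
  "proj_vac * (sigma_x lam * sigma_plus) = of_real lam \<cdot>\<^sub>m proj_vac"
  "sigma_minus * (sigma_x lam * proj_vac) = of_real lam \<cdot>\<^sub>m proj_vac"
  "sigma_minus * (sigma_x lam * sigma_plus) = 0\<^sub>m 2 2"
  by (rule mat_2_eqI;
      simp add: proj_vac_def sigma_x_def mat_2_mult_index power2_eq_square mult_carrier_mat[of _ 2 2 _ 2]
        del: index_mult_mat(1))+

section \<open>The interaction\<close>

lemma zero_smult_mat: "A \<in> carrier_mat m n \<Longrightarrow> 0 \<cdot>\<^sub>m A = (0\<^sub>m m n :: 'a :: mult_zero mat)"
  by (rule eq_matI) auto

text \<open>A on the initial system times W on field factor l. As a product of two commuting
  embeddings it needs no mention of the factors in between.\<close>

definition ten :: "nat \<Rightarrow> nat \<Rightarrow> complex mat \<Rightarrow> complex mat \<Rightarrow> complex mat" where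
  "ten k l A W = init k A * emb k l W"

locale sites =
  fixes k n :: nat
  assumes n: "n = dimn k"
begin

lemma emb_carrier_n [simp]: "X \<in> carrier_mat 2 2 \<Longrightarrow> i \<le> k \<Longrightarrow> emb k i X \<in> carrier_mat n n"
  unfolding n by (rule emb_carrier)

lemma emb_one_n: "i \<le> k \<Longrightarrow> emb k i (1\<^sub>m 2) = 1\<^sub>m n"
  unfolding n by (rule emb_one)

lemma ten_carrier [simp]:
  "A \<in> carrier_mat 2 2 \<Longrightarrow> W \<in> carrier_mat 2 2 \<Longrightarrow> l \<le> k \<Longrightarrow> ten k l A W \<in> carrier_mat n n"
  unfolding ten_def by (intro mult_carrier_mat[of _ n n]) auto

lemma ten_adjoint:
  assumes "A \<in> carrier_mat 2 2" "W \<in> carrier_mat 2 2" "l \<in> {1..k}"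
  shows "mat_adjoint (ten k l A W) = ten k l (mat_adjoint A) (mat_adjoint W)"
  unfolding ten_def using assms
  by (simp add: mat_adjoint_mult[of _ n n _ n] emb_adjoint emb_commute[of _ _ l 0])

lemma ten_mult:
  assumes "A \<in> carrier_mat 2 2" "W \<in> carrier_mat 2 2" "B \<in> carrier_mat 2 2" "V \<in> carrier_mat 2 2" "l \<in> {1..k}"
  shows "ten k l A W * ten k l B V = ten k l (A * B) (W * V)"
proof -
  have car: "init k A \<in> carrier_mat n n" "emb k l W \<in> carrier_mat n n" "init k B \<in> carrier_mat n n" "emb k l V \<in> carrier_mat n n"
    using assms by auto
  have "(init k A * emb k l W) * (init k B * emb k l V) = init k A * (emb k l W * (init k B * emb k l V))"
    using car by (intro assoc_mult_mat[of _ n n _ n _ n] mult_carrier_mat[of _ n n])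
  also have "emb k l W * (init k B * emb k l V) = (emb k l W * init k B) * emb k l V"
    using car by (intro assoc_mult_mat[symmetric, of _ n n _ n _ n])
  also have "emb k l W * init k B = init k B * emb k l W"
    using assms by (intro emb_commute) auto
  also have "(init k B * emb k l W) * emb k l V = init k B * (emb k l W * emb k l V)"
    using car by (intro assoc_mult_mat[of _ n n _ n _ n])
  also have "init k A * \<dots> = (init k A * init k B) * (emb k l W * emb k l V)"
    using car by (intro assoc_mult_mat[symmetric, of _ n n _ n _ n] mult_carrier_mat[of _ n n])
  finally show ?thesis using assms by (simp add: ten_def emb_mult)
qed

lemma ten_add_left:
  "A \<in> carrier_mat 2 2 \<Longrightarrow> B \<in> carrier_mat 2 2 \<Longrightarrow> W \<in> carrier_mat 2 2 \<Longrightarrow> l \<le> k \<Longrightarrow>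
    ten k l (A + B) W = ten k l A W + ten k l B W"
  unfolding ten_def by (simp add: emb_add add_mult_distrib_mat[of _ n n _ _ n])

lemma ten_smult_left:
  "A \<in> carrier_mat 2 2 \<Longrightarrow> W \<in> carrier_mat 2 2 \<Longrightarrow> l \<le> k \<Longrightarrow> ten k l (c \<cdot>\<^sub>m A) W = c \<cdot>\<^sub>m ten k l A W"
  unfolding ten_def by (simp add: emb_smult mult_smult_assoc_mat[of _ n n _ n])

lemma ten_smult_right:
  "A \<in> carrier_mat 2 2 \<Longrightarrow> W \<in> carrier_mat 2 2 \<Longrightarrow> l \<le> k \<Longrightarrow> ten k l A (c \<cdot>\<^sub>m W) = c \<cdot>\<^sub>m ten k l A W"
  unfolding ten_def by (simp add: emb_smult mult_smult_distrib[of _ n n _ n])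

lemma ten_one_right: "A \<in> carrier_mat 2 2 \<Longrightarrow> l \<le> k \<Longrightarrow> ten k l A (1\<^sub>m 2) = init k A"
  unfolding ten_def by (simp add: emb_one_n right_mult_one_mat[of _ n n])

lemma ten_one_left: "W \<in> carrier_mat 2 2 \<Longrightarrow> l \<le> k \<Longrightarrow> ten k l (1\<^sub>m 2) W = emb k l W"
  unfolding ten_def by (simp add: emb_one_n left_mult_one_mat[of _ n n])

lemma ten_zero_right: "A \<in> carrier_mat 2 2 \<Longrightarrow> l \<le> k \<Longrightarrow> ten k l A (0\<^sub>m 2 2) = 0\<^sub>m n n"
proof -
  assume *: "A \<in> carrier_mat 2 2" "l \<le> k"
  have "0\<^sub>m 2 2 = 0 \<cdot>\<^sub>m (1\<^sub>m 2 :: complex mat)" by (rule eq_matI) auto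
  then have "ten k l A (0\<^sub>m 2 2) = 0 \<cdot>\<^sub>m ten k l A (1\<^sub>m 2)"
    using ten_smult_right[of A "1\<^sub>m 2" l 0] * by simp
  also have "\<dots> = 0\<^sub>m n n" using * by (intro zero_smult_mat ten_carrier) auto
  finally show ?thesis .
qed

text \<open>The operators commuting with all of factor l. This is the form in which causality is
  used: it holds for whatever is built from the initial system and other factors.\<close>

definition site_commutant :: "nat \<Rightarrow> complex mat set" where
  "site_commutant l = {A \<in> carrier_mat n n. \<forall>W \<in> carrier_mat 2 2. A * emb k l W = emb k l W * A}"

lemma site_commutantD:
  "A \<in> site_commutant l \<Longrightarrow> A \<in> carrier_mat n n"
  "A \<in> site_commutant l \<Longrightarrow> W \<in> carrier_mat 2 2 \<Longrightarrow> A * emb k l W = emb k l W * A"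
  by (auto simp: site_commutant_def)

lemma site_commutant_mult:
  "l \<le> k \<Longrightarrow> A \<in> site_commutant l \<Longrightarrow> B \<in> site_commutant l \<Longrightarrow> A * B \<in> site_commutant l"
  unfolding site_commutant_def by (auto intro!: mult_commute_left[of _ n])

lemma site_commutant_add:
  "l \<le> k \<Longrightarrow> A \<in> site_commutant l \<Longrightarrow> B \<in> site_commutant l \<Longrightarrow> A + B \<in> site_commutant l"
  unfolding site_commutant_def
  by (simp add: add_mult_distrib_mat[of _ n n _ _ n] mult_add_distrib_mat[of _ n n _ n])

lemma site_commutant_smult: "l \<le> k \<Longrightarrow> A \<in> site_commutant l \<Longrightarrow> c \<cdot>\<^sub>m A \<in> site_commutant l"
  unfolding site_commutant_def
  by (simp add: mult_smult_distrib[of _ n n _ n] mult_smult_assoc_mat[of _ n n _ n])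

lemma site_commutant_one: "l \<le> k \<Longrightarrow> 1\<^sub>m n \<in> site_commutant l"
  unfolding site_commutant_def
  by (simp add: left_mult_one_mat[of _ n n] right_mult_one_mat[of _ n n])

lemma site_commutant_adjoint:
  assumes l: "l \<le> k" and A: "A \<in> site_commutant l"
  shows "mat_adjoint A \<in> site_commutant l"
proof -
  have Ac: "A \<in> carrier_mat n n" using A by (rule site_commutantD)
  have "mat_adjoint A * emb k l W = emb k l W * mat_adjoint A" if W: "W \<in> carrier_mat 2 2" for W
  proof -
    have "mat_adjoint (emb k l (mat_adjoint W) * A) = mat_adjoint (A * emb k l (mat_adjoint W))"
      using site_commutantD(2)[OF A, of "mat_adjoint W"] W by simp
    then show ?thesis
      using W l Ac by (simp add: mat_adjoint_mult[of _ n n _ n] emb_adjoint)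
  qed
  then show ?thesis using Ac by (simp add: site_commutant_def)
qed

lemma emb_site_commutant:
  "X \<in> carrier_mat 2 2 \<Longrightarrow> i \<noteq> l \<Longrightarrow> i \<le> k \<Longrightarrow> l \<le> k \<Longrightarrow> emb k i X \<in> site_commutant l"
  unfolding site_commutant_def by (auto intro: emb_commute)

lemma ten_site_commutant:
  "A \<in> carrier_mat 2 2 \<Longrightarrow> W \<in> carrier_mat 2 2 \<Longrightarrow> i \<noteq> l \<Longrightarrow> i \<le> k \<Longrightarrow> l \<in> {1..k} \<Longrightarrow>
    ten k i A W \<in> site_commutant l"
  unfolding ten_def by (intro site_commutant_mult emb_site_commutant) auto

lemma star_alg_site_commutant:
  assumes l: "l \<le> k" and S: "S \<subseteq> site_commutant l"
  shows "A \<in> star_alg n S \<Longrightarrow> A \<in> site_commutant l"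
  by (induction rule: star_alg.induct)
    (use l S in \<open>auto intro: site_commutant_mult site_commutant_add site_commutant_smult
      site_commutant_one site_commutant_adjoint\<close>)

text \<open>The excited projection sigma_+ sigma_- at a field factor has expectation zero, hence
  drops out of every expectation on either side. Its complement, the vacuum projection, can thus be
  inserted or removed at will.\<close>

lemma emb_vac_null:
  assumes \<rho>: "is_state 2 \<rho>" and l: "l \<in> {1..k}" and G: "G \<in> carrier_mat n n"
  shows "total_state k \<rho> (G * emb k l proj_vac) = total_state k \<rho> G"
    "total_state k \<rho> (emb k l proj_vac * G) = total_state k \<rho> G"
proof -
  let ?P = "total_state k \<rho>" and ?E = "emb k l (sigma_plus * sigma_minus)"
  have P: "is_state n ?P" using total_state_is_state[OF \<rho>] n by simp
  have E: "?E \<in> carrier_mat n n" and Ev: "emb k l proj_vac \<in> carrier_mat n n" using l by simp_all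
  have lin: "linear_functional 2 \<rho>" using \<rho> by (simp add: is_state_def)
  have adj: "mat_adjoint ?E = ?E" by (simp add: emb_adjoint spin_adjoint)
  have "?P ?E = \<rho> (0 \<cdot>\<^sub>m 1\<^sub>m 2)"
    using l by (simp add: total_state_eq[OF lin] vac_compress_emb mat_2_mult_index del: index_mult_mat(1))
  then have "?P ?E = 0" by (simp add: state_smult[OF \<rho>])
  moreover have "?E * ?E = ?E" by (simp add: emb_mult spin_mult)
  ultimately have null: "?P (mat_adjoint ?E * ?E) = 0" by (simp add: adj)
  have one: "?E + emb k l proj_vac = 1\<^sub>m n"
    using l by (simp add: spin_mult emb_one_n flip: emb_add)
  have "?P G = ?P (G * (?E + emb k l proj_vac))"
    using G by (simp add: one right_mult_one_mat[of _ n n])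
  also have "\<dots> = ?P (G * ?E) + ?P (G * emb k l proj_vac)"
    using G E Ev by (simp add: mult_add_distrib_mat[of _ n n _ n] state_add[OF P])
  finally show "?P (G * emb k l proj_vac) = ?P G"
    using state_null_left_right(1)[OF P E G null] by simp
  have "?P G = ?P ((?E + emb k l proj_vac) * G)"
    using G by (simp add: one left_mult_one_mat[of _ n n])
  also have "\<dots> = ?P (?E * G) + ?P (emb k l proj_vac * G)"
    using G E Ev by (simp add: add_mult_distrib_mat[of _ n n _ _ n] state_add[OF P])
  finally show "?P (emb k l proj_vac * G) = ?P G"
    using state_null_left_right(2)[OF P E G null] by (simp add: adj)
qed

end

lemma minus_eq_imp_eq_add:
  "A \<in> carrier_mat m n \<Longrightarrow> B \<in> carrier_mat m n \<Longrightarrow> A - B = C \<Longrightarrow> A = C + (B :: complex mat)"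
  by (intro eq_matI) auto

lemma mat_add_rotate:
  assumes "A \<in> carrier_mat n n" "B \<in> carrier_mat n n" "C \<in> carrier_mat n n" "D \<in> carrier_mat n n"
  shows "A + C + B + D = A + B + C + (D :: complex mat)"
  using assms by (intro eq_matI) auto

section \<open>Unitary evolution and the observation algebra\<close>

locale repeated_interaction = sites +
  fixes lam :: real and L1 L2 L3 Mpm Mp Mm Mo :: "complex mat"
  assumes lam: "lam \<noteq> 0"
    and L: "L1 \<in> carrier_mat 2 2" "L2 \<in> carrier_mat 2 2" "L3 \<in> carrier_mat 2 2"
    and selfadjoint: "mat_adjoint L1 = L1" "mat_adjoint L3 = L3"
    and M: "Mpm \<in> carrier_mat 2 2" "Mp \<in> carrier_mat 2 2"
      "Mm \<in> carrier_mat 2 2" "Mo \<in> carrier_mat 2 2"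
    and M_eq: "\<And>i. i \<in> {1..k} \<Longrightarrow>
      Mint k lam L1 L2 L3 i - 1\<^sub>m (dimn k) =
        init k Mpm * dLam k i + init k Mp * dAstar k lam i
          + init k Mm * dA k lam i + init k Mo * dt k lam i"
begin

abbreviation "U \<equiv> Uint k lam L1 L2 L3"
abbreviation "x \<equiv> dY k lam L1 L2 L3"
abbreviation "j \<equiv> jmap k lam L1 L2 L3"
abbreviation "Mi \<equiv> Mint k lam L1 L2 L3"
text \<open>The coefficient with which one interaction leaves the vacuum in the vacuum: the identity
  and the time term together.\<close>

abbreviation "m0 \<equiv> 1\<^sub>m 2 + of_real (lam\<^sup>2) \<cdot>\<^sub>m Mo"

lemma generator_ten:
  assumes "A \<in> carrier_mat 2 2" "B \<in> carrier_mat 2 2" "C \<in> carrier_mat 2 2" "D \<in> carrier_mat 2 2" "l \<in> {1..k}"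
  shows "init k A * dLam k l + init k B * dAstar k lam l + init k C * dA k lam l + init k D * dt k lam l
    = ten k l A (sigma_plus * sigma_minus) + of_real lam \<cdot>\<^sub>m ten k l B sigma_plus
      + of_real lam \<cdot>\<^sub>m ten k l C sigma_minus + of_real (lam\<^sup>2) \<cdot>\<^sub>m ten k l D (1\<^sub>m 2)"
  using assms unfolding dLam_def dAstar_def dA_def dt_def ten_def n[symmetric]
  by (simp add: mult_smult_distrib[of _ n n _ n] emb_one_n)

lemma Mi_ten:
  assumes l: "l \<in> {1..k}"
  shows "Mi l \<in> carrier_mat n n"
    "Mi l = ten k l Mpm (sigma_plus * sigma_minus) + of_real lam \<cdot>\<^sub>m ten k l Mp sigma_plus
      + of_real lam \<cdot>\<^sub>m ten k l Mm sigma_minus + of_real (lam\<^sup>2) \<cdot>\<^sub>m ten k l Mo (1\<^sub>m 2) + 1\<^sub>m n"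
proof -
  show car: "Mi l \<in> carrier_mat n n"
    unfolding Mint_def generator_ten[OF L(1) L(2) mat_adjoint_carrier[OF L(2)] L(3) l]
    using L l by (intro mat_exp_carrier smult_carrier_mat add_carrier_mat ten_carrier) auto
  show "Mi l = ten k l Mpm (sigma_plus * sigma_minus) + of_real lam \<cdot>\<^sub>m ten k l Mp sigma_plus
      + of_real lam \<cdot>\<^sub>m ten k l Mm sigma_minus + of_real (lam\<^sup>2) \<cdot>\<^sub>m ten k l Mo (1\<^sub>m 2) + 1\<^sub>m n"
    using M_eq[OF l] unfolding generator_ten[OF M l] n[symmetric]
    by (intro minus_eq_imp_eq_add[OF car]) simp_all
qed

lemma Mi_unitary:
  assumes l: "l \<in> {1..k}"
  shows "mat_adjoint (Mi l) * Mi l = 1\<^sub>m n" "Mi l * mat_adjoint (Mi l) = 1\<^sub>m n"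
proof -
  let ?H = "ten k l L1 (sigma_plus * sigma_minus) + of_real lam \<cdot>\<^sub>m ten k l L2 sigma_plus
      + of_real lam \<cdot>\<^sub>m ten k l (mat_adjoint L2) sigma_minus + of_real (lam\<^sup>2) \<cdot>\<^sub>m ten k l L3 (1\<^sub>m 2)"
  have lk: "l \<le> k" using l by simp
  have car: "ten k l L1 (sigma_plus * sigma_minus) \<in> carrier_mat n n" "of_real lam \<cdot>\<^sub>m ten k l L2 sigma_plus \<in> carrier_mat n n"
    "of_real lam \<cdot>\<^sub>m ten k l (mat_adjoint L2) sigma_minus \<in> carrier_mat n n" "of_real (lam\<^sup>2) \<cdot>\<^sub>m ten k l L3 (1\<^sub>m 2) \<in> carrier_mat n n"
    using L l by (intro smult_carrier_mat ten_carrier; auto)+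
  then have H: "?H \<in> carrier_mat n n" by simp
  have "mat_adjoint ?H = ten k l L1 (sigma_plus * sigma_minus) + of_real lam \<cdot>\<^sub>m ten k l (mat_adjoint L2) sigma_minus
      + of_real lam \<cdot>\<^sub>m ten k l L2 sigma_plus + of_real (lam\<^sup>2) \<cdot>\<^sub>m ten k l L3 (1\<^sub>m 2)"
    using car L l
    by (simp add: sq_adjoint[where n = n] mat_adjoint_smult ten_adjoint spin_adjoint selfadjoint)
  \<comment> \<open>Taking adjoints has exchanged the two middle summands; the sum is the
    same.\<close>
  then have "mat_adjoint ?H = ?H" by (simp only: mat_add_rotate[OF car])
  then have skew: "mat_adjoint ((- \<i>) \<cdot>\<^sub>m ?H) = (-1) \<cdot>\<^sub>m ((- \<i>) \<cdot>\<^sub>m ?H)"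
    by (simp add: mat_adjoint_smult smult_smult_mat)
  have "Mi l = mat_exp ((- \<i>) \<cdot>\<^sub>m ?H)"
    unfolding Mint_def generator_ten[OF L(1) L(2) mat_adjoint_carrier[OF L(2)] L(3) l] ..
  then show "mat_adjoint (Mi l) * Mi l = 1\<^sub>m n" "Mi l * mat_adjoint (Mi l) = 1\<^sub>m n"
    using mat_exp_unitary[OF _ skew] H by simp_all
qed

text \<open>Read off from the expansion \<open>M_eq\<close>, in which only the initial system and
  factor i occur; the exponential series is not consulted.\<close>

lemma Mi_site_commutant: "i \<in> {1..k} \<Longrightarrow> l \<in> {1..k} \<Longrightarrow> i \<noteq> l \<Longrightarrow> Mi i \<in> site_commutant l"
  using M by (auto simp: Mi_ten(2) intro!: site_commutant_add site_commutant_smult site_commutant_one ten_site_commutant)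

lemma U_0: "U 0 = 1\<^sub>m n"
  by (simp only: Uint.simps n)

lemma U_Suc: "U (Suc l) = Mi (Suc l) * U l"
  by simp

declare Uint.simps [simp del]

lemma U_carrier: "l \<le> k \<Longrightarrow> U l \<in> carrier_mat n n"
proof (induction l)
  case (Suc l)
  then show ?case unfolding U_Suc by (intro mult_carrier_mat[of _ n n] Mi_ten(1)) auto
qed (simp add: U_0)

lemma U_unitary: "l \<le> k \<Longrightarrow> mat_adjoint (U l) * U l = 1\<^sub>m n \<and> U l * mat_adjoint (U l) = 1\<^sub>m n"
proof (induction l)
  case 0
  then show ?case by (simp add: U_0)
next
  case (Suc l)
  let ?M = "Mi (Suc l)"
  have car: "?M \<in> carrier_mat n n" "U l \<in> carrier_mat n n" "mat_adjoint ?M \<in> carrier_mat n n" "mat_adjoint (U l) \<in> carrier_mat n n"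
    using Suc.prems Mi_ten(1) U_carrier by auto
  have adj: "mat_adjoint (U (Suc l)) = mat_adjoint (U l) * mat_adjoint ?M"
    unfolding U_Suc by (rule mat_adjoint_mult[OF car(1,2)])
  have "mat_adjoint (U (Suc l)) * U (Suc l) = mat_adjoint (U l) * ((mat_adjoint ?M * ?M) * U l)"
    unfolding adj unfolding U_Suc using car by (simp add: assoc_mult_mat[of _ n n _ n _ n] sq_carrier[where n = n])
  moreover have "U (Suc l) * mat_adjoint (U (Suc l)) = ?M * ((U l * mat_adjoint (U l)) * mat_adjoint ?M)"
    unfolding adj unfolding U_Suc using car by (simp add: assoc_mult_mat[of _ n n _ n _ n] sq_carrier[where n = n])
  ultimately show ?case
    using Mi_unitary[of "Suc l"] Suc car by (simp add: left_mult_one_mat[of _ n n])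
qed

lemma U_site_commutant: "i < l \<Longrightarrow> l \<le> k \<Longrightarrow> U i \<in> site_commutant l"
proof (induction i)
  case 0
  then show ?case using site_commutant_one by (simp add: U_0)
next
  case (Suc i)
  then show ?case unfolding U_Suc by (intro site_commutant_mult Mi_site_commutant Suc.IH) auto
qed

lemma conj_mult:
  assumes "l \<le> k" "A \<in> carrier_mat n n" "B \<in> carrier_mat n n"
  shows "(mat_adjoint (U l) * A * U l) * (mat_adjoint (U l) * B * U l) = mat_adjoint (U l) * (A * B) * U l"
proof -
  have car: "U l \<in> carrier_mat n n" "mat_adjoint (U l) \<in> carrier_mat n n" using U_carrier assms by auto
  have "(mat_adjoint (U l) * A * U l) * (mat_adjoint (U l) * B * U l)
    = mat_adjoint (U l) * (A * ((U l * mat_adjoint (U l)) * (B * U l)))"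
    using car assms by (simp add: assoc_mult_mat[of _ n n _ n _ n] sq_carrier[where n = n])
  also have "\<dots> = mat_adjoint (U l) * (A * B) * U l"
    using car assms U_unitary by (simp add: assoc_mult_mat[of _ n n _ n _ n] sq_carrier[where n = n] left_mult_one_mat[of _ n n])
  finally show ?thesis .
qed

text \<open>Once factor i has interacted, later unitaries commute with it and cancel. So all
  observations can be written with one common unitary.\<close>

lemma x_U:
  assumes "i \<in> {1..k}" "i \<le> l" "l \<le> k"
  shows "x i = mat_adjoint (U l) * emb k i (sigma_x lam) * U l"
  using assms(2,3)
proof (induction l rule: dec_induct)
  case base
  have "dA k lam i + dAstar k lam i = emb k i (sigma_x lam)"
    using assms by (simp add: dA_def dAstar_def sigma_x_def emb_add emb_smult)
  then show ?case by (simp add: dY_def)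
next
  case (step l)
  let ?M = "Mi (Suc l)" and ?S = "emb k i (sigma_x lam)"
  have car: "?M \<in> carrier_mat n n" "U l \<in> carrier_mat n n" "?S \<in> carrier_mat n n"
    using step assms Mi_ten(1) U_carrier by auto
  note car' = car mat_adjoint_carrier[OF car(1)] mat_adjoint_carrier[OF car(2)]
  have "mat_adjoint (U (Suc l)) * ?S * U (Suc l) = mat_adjoint (U l) * (mat_adjoint ?M * (?S * ?M)) * U l"
    unfolding U_Suc mat_adjoint_mult[OF car(1,2)] using car'
    by (simp add: sq_carrier[where n = n] assoc_mult_mat[of _ n n _ n _ n])
  also have "?S * ?M = ?M * ?S"
    using site_commutantD(2)[OF Mi_site_commutant[of "Suc l" i], of "sigma_x lam"] step assms by simp
  also have "mat_adjoint ?M * (?M * ?S) = (mat_adjoint ?M * ?M) * ?S"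
    using car' by (intro assoc_mult_mat[symmetric, of _ n n _ n _ n])
  finally show ?case using Mi_unitary[of "Suc l"] step car by (simp add: left_mult_one_mat[of _ n n])
qed

text \<open>At time k all observations are conjugates, by the same unitary, of quadratures at
  different factors, and inherit their relations.\<close>

sublocale commuting_involutions n k lam x
proof
  fix i assume i: "i \<in> {1..k}"
  have car: "U k \<in> carrier_mat n n" "emb k i (sigma_x lam) \<in> carrier_mat n n" using U_carrier i by auto
  have xi: "x i = mat_adjoint (U k) * emb k i (sigma_x lam) * U k" using x_U[OF i, of k] i by simp
  show "x i \<in> carrier_mat n n" unfolding xi using car by (simp add: sq_carrier[where n = n])
  show "mat_adjoint (x i) = x i"
    unfolding xi using car
    by (simp add: sq_adjoint[where n = n] sq_carrier[where n = n] emb_adjoint spin_adjoint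
        assoc_mult_mat[of _ n n _ n _ n])
  have "x i * x i = mat_adjoint (U k) * (of_real (lam\<^sup>2) \<cdot>\<^sub>m 1\<^sub>m n) * U k"
    unfolding xi using car i by (simp add: conj_mult emb_mult spin_mult emb_smult emb_one_n)
  then show "x i * x i = of_real (lam\<^sup>2) \<cdot>\<^sub>m 1\<^sub>m n"
    using car U_unitary[of k]
    by (simp add: mult_smult_distrib[of _ n n _ n] mult_smult_assoc_mat[of _ n n _ n] right_mult_one_mat[of _ n n])
  fix i' assume i': "i' \<in> {1..k}"
  have xi': "x i' = mat_adjoint (U k) * emb k i' (sigma_x lam) * U k" using x_U[OF i', of k] i' by simp
  have "emb k i (sigma_x lam) * emb k i' (sigma_x lam) = emb k i' (sigma_x lam) * emb k i (sigma_x lam)"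
    using i i' by (cases "i = i'") (auto intro: emb_commute)
  then show "x i * x i' = x i' * x i"
    unfolding xi xi' using i i' by (simp add: conj_mult)
qed (rule lam)

lemma Y_site_commutant: "i < l \<Longrightarrow> l \<le> k \<Longrightarrow> A \<in> Y i \<Longrightarrow> A \<in> site_commutant l"
proof (rule star_alg_site_commutant[of l "x ` {1..i}"])
  assume il: "i < l" "l \<le> k"
  show "x ` {1..i} \<subseteq> site_commutant l"
  proof safe
    fix r assume r: "r \<in> {1..i}"
    then show "x r \<in> site_commutant l"
      using il
      by (subst x_U[of r r]) (auto intro!: site_commutant_mult site_commutant_adjoint U_site_commutant emb_site_commutant)
  qed
qed auto

end

section \<open>One interaction step compressed to the vacuum\<close>

lemma mult_add_add_mat:
  assumes "A \<in> carrier_mat n n" "B \<in> carrier_mat n n" "C \<in> carrier_mat n n" "D \<in> carrier_mat n n"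
  shows "(A + B) * (C + D) = (A * C + A * D) + (B * C + B * D)"
  unfolding add_mult_distrib_mat[OF assms(1,2) add_carrier_mat[OF assms(4)]]
    mult_add_distrib_mat[OF assms(1,3,4)] mult_add_distrib_mat[OF assms(2,3,4)] ..

lemma smult_combination_4:
  fixes A B C D :: "complex mat"
  assumes "A \<in> carrier_mat n n" "B \<in> carrier_mat n n" "C \<in> carrier_mat n n" "D \<in> carrier_mat n n"
  shows "(a \<cdot>\<^sub>m A + t \<cdot>\<^sub>m (b \<cdot>\<^sub>m B)) + (t \<cdot>\<^sub>m (c \<cdot>\<^sub>m C) + t \<cdot>\<^sub>m (t \<cdot>\<^sub>m (d \<cdot>\<^sub>m D)))
    = a \<cdot>\<^sub>m A + (t * b) \<cdot>\<^sub>m B + (t * c) \<cdot>\<^sub>m C + (t\<^sup>2 * d) \<cdot>\<^sub>m D"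
  using assms by (intro eq_matI) (auto simp: power2_eq_square)

context repeated_interaction
begin

text \<open>The terms with \<open>Mpm\<close> and \<open>Mm\<close> vanish on the vacuum, so these
  coefficients do not occur in the filter. The identity and the time term merge into
  \<open>m0\<close>.\<close>

lemma Mi_vac:
  assumes l: "l \<in> {1..k}"
  shows "Mi l * emb k l proj_vac = ten k l m0 proj_vac + of_real lam \<cdot>\<^sub>m ten k l Mp sigma_plus"
proof -
  have car: "emb k l proj_vac \<in> carrier_mat n n" "ten k l Mpm (sigma_plus * sigma_minus) \<in> carrier_mat n n"
    "ten k l Mp sigma_plus \<in> carrier_mat n n" "ten k l Mm sigma_minus \<in> carrier_mat n n"
    "ten k l Mo (1\<^sub>m 2) \<in> carrier_mat n n" "ten k l Mo proj_vac \<in> carrier_mat n n"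
    using M l by simp_all
  have mult: "ten k l A W * emb k l proj_vac = ten k l A (W * proj_vac)"
    if "A \<in> carrier_mat 2 2" "W \<in> carrier_mat 2 2" for A W
    using ten_mult[of A W "1\<^sub>m 2" proj_vac l] that l
    by (simp add: ten_one_left right_mult_one_mat[of _ 2 2])
  have "Mi l * emb k l proj_vac = 0\<^sub>m n n + of_real lam \<cdot>\<^sub>m ten k l Mp sigma_plus + of_real lam \<cdot>\<^sub>m 0\<^sub>m n n
      + of_real (lam\<^sup>2) \<cdot>\<^sub>m ten k l Mo proj_vac + emb k l proj_vac"
    unfolding Mi_ten(2)[OF l] using car M l
    by (simp add: sq_carrier[where n = n] add_mult_distrib_mat[of _ n n _ _ n] mult_smult_assoc_mat[of _ n n _ n]
        mult spin_mult ten_zero_right left_mult_one_mat[of _ n n] left_mult_one_mat[of _ 2 2])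
  also have "\<dots> = emb k l proj_vac + of_real (lam\<^sup>2) \<cdot>\<^sub>m ten k l Mo proj_vac + of_real lam \<cdot>\<^sub>m ten k l Mp sigma_plus"
    using car by (intro eq_matI) auto
  also have "emb k l proj_vac + of_real (lam\<^sup>2) \<cdot>\<^sub>m ten k l Mo proj_vac = ten k l m0 proj_vac"
    using M l by (simp add: ten_add_left ten_smult_left ten_one_left)
  finally show ?thesis .
qed

text \<open>The scalars a, b, c, d are the matrix elements of W between the vacuum and the vector
  created by sigma_+. Two cases are used later: W = 1, where a = d = 1 and b = c = 0, and W the
  quadrature, where a = d = 0 and b = c = lam.\<close>

lemma vac_expectation:
  assumes \<rho>: "is_state 2 \<rho>" and l: "Suc l \<le> k" and C: "C \<in> Y l"
    and A: "A \<in> carrier_mat 2 2" and W: "W \<in> carrier_mat 2 2"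
    and W_eq: "proj_vac * (W * proj_vac) = a \<cdot>\<^sub>m proj_vac" "proj_vac * (W * sigma_plus) = b \<cdot>\<^sub>m proj_vac"
      "sigma_minus * (W * proj_vac) = c \<cdot>\<^sub>m proj_vac" "sigma_minus * (W * sigma_plus) = d \<cdot>\<^sub>m proj_vac"
  shows "total_state k \<rho> (mat_adjoint (U (Suc l)) * ten k (Suc l) A W * U (Suc l) * C)
    = total_state k \<rho> (j l (a \<cdot>\<^sub>m (mat_adjoint m0 * A * m0) + (of_real lam * b) \<cdot>\<^sub>m (mat_adjoint m0 * A * Mp)
        + (of_real lam * c) \<cdot>\<^sub>m (mat_adjoint Mp * A * m0)
        + (of_real (lam\<^sup>2) * d) \<cdot>\<^sub>m (mat_adjoint Mp * A * Mp)) * C)"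
    (is "_ = total_state k \<rho> (j l ?Xi * C)")
proof -
  let ?P = "total_state k \<rho>" and ?M = "Mi (Suc l)" and ?E = "emb k (Suc l) proj_vac"
    and ?Z = "ten k (Suc l) A W" and ?V = "U l" and ?D = "U l * C"
    and ?K = "ten k (Suc l) m0 proj_vac + of_real lam \<cdot>\<^sub>m ten k (Suc l) Mp sigma_plus"
    and ?K' = "ten k (Suc l) (mat_adjoint m0) proj_vac + of_real lam \<cdot>\<^sub>m ten k (Suc l) (mat_adjoint Mp) sigma_minus"
  have l': "Suc l \<in> {1..k}" "l \<le> k" using l by simp_all
  have m0: "m0 \<in> carrier_mat 2 2" using M by simp
  have Xi: "?Xi \<in> carrier_mat 2 2" using M A m0 by (simp add: sq_carrier[where n = 2])
  have car: "?M \<in> carrier_mat n n" "?E \<in> carrier_mat n n" "?Z \<in> carrier_mat n n" "?V \<in> carrier_mat n n"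
    "C \<in> carrier_mat n n" "mat_adjoint ?V \<in> carrier_mat n n" "mat_adjoint ?M \<in> carrier_mat n n"
    "init k ?Xi \<in> carrier_mat n n" "?D \<in> carrier_mat n n"
    using A W l l' Mi_ten(1)[OF l'(1)] U_carrier[OF l'(2)] Y_carrier[OF l'(2) C] Xi by (auto intro: mult_carrier_mat)
  have comm: "?E * mat_adjoint ?V = mat_adjoint ?V * ?E" "?D * ?E = ?E * ?D"
    using site_commutantD(2)[of "mat_adjoint ?V" "Suc l" proj_vac] site_commutantD(2)[of ?D "Suc l" proj_vac] l
      U_site_commutant[of l "Suc l"] Y_site_commutant[of l "Suc l" C] C
    by (simp_all add: site_commutant_mult site_commutant_adjoint)
  have K: "?M * ?E = ?K" by (rule Mi_vac[OF l'(1)])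
  have "?E * mat_adjoint ?M = mat_adjoint (?M * ?E)"
    using car by (simp add: mat_adjoint_mult[of _ n n _ n] emb_adjoint spin_adjoint)
  also have "\<dots> = ?K'"
    unfolding K using m0 M l
    by (simp add: mat_adjoint_add[of _ n n] mat_adjoint_smult ten_adjoint spin_adjoint)
  finally have K': "?E * mat_adjoint ?M = ?K'" .
  have KZK: "?K' * (?Z * ?K) = ten k (Suc l) ?Xi proj_vac"
  proof -
    have ZK: "?Z * ?K = ten k (Suc l) (A * m0) (W * proj_vac) + of_real lam \<cdot>\<^sub>m ten k (Suc l) (A * Mp) (W * sigma_plus)"
      using m0 M A W l
      by (simp add: mult_add_distrib_mat[of _ n n _ n] mult_smult_distrib[of _ n n _ n] ten_mult)
    let ?t = "\<lambda>B. ten k (Suc l) B proj_vac"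
    have prods: "ten k (Suc l) (mat_adjoint m0) proj_vac * ten k (Suc l) (A * m0) (W * proj_vac)
          = a \<cdot>\<^sub>m ?t (mat_adjoint m0 * (A * m0))"
        "ten k (Suc l) (mat_adjoint m0) proj_vac * (of_real lam \<cdot>\<^sub>m ten k (Suc l) (A * Mp) (W * sigma_plus))
          = of_real lam \<cdot>\<^sub>m (b \<cdot>\<^sub>m ?t (mat_adjoint m0 * (A * Mp)))"
        "(of_real lam \<cdot>\<^sub>m ten k (Suc l) (mat_adjoint Mp) sigma_minus) * ten k (Suc l) (A * m0) (W * proj_vac)
          = of_real lam \<cdot>\<^sub>m (c \<cdot>\<^sub>m ?t (mat_adjoint Mp * (A * m0)))"
        "(of_real lam \<cdot>\<^sub>m ten k (Suc l) (mat_adjoint Mp) sigma_minus) * (of_real lam \<cdot>\<^sub>m ten k (Suc l) (A * Mp) (W * sigma_plus))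
          = of_real lam \<cdot>\<^sub>m (of_real lam \<cdot>\<^sub>m (d \<cdot>\<^sub>m ?t (mat_adjoint Mp * (A * Mp))))"
      using m0 M A W l
      by (simp_all add: sq_carrier[where n = 2] mult_smult_distrib[of _ n n _ n] mult_smult_assoc_mat[of _ n n _ n]
          ten_mult W_eq ten_smult_right del: assoc_mult_mat)
    have "?K' * (?Z * ?K) =
        (a \<cdot>\<^sub>m ?t (mat_adjoint m0 * (A * m0)) + of_real lam \<cdot>\<^sub>m (b \<cdot>\<^sub>m ?t (mat_adjoint m0 * (A * Mp))))
        + (of_real lam \<cdot>\<^sub>m (c \<cdot>\<^sub>m ?t (mat_adjoint Mp * (A * m0)))
        + of_real lam \<cdot>\<^sub>m (of_real lam \<cdot>\<^sub>m (d \<cdot>\<^sub>m ?t (mat_adjoint Mp * (A * Mp)))))"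
      unfolding ZK prods[symmetric] using m0 M A W l
      by (intro mult_add_add_mat[of _ n] smult_carrier_mat ten_carrier mult_carrier_mat[of _ 2 2]) auto
    also have "\<dots> = a \<cdot>\<^sub>m ?t (mat_adjoint m0 * (A * m0)) + (of_real lam * b) \<cdot>\<^sub>m ?t (mat_adjoint m0 * (A * Mp))
        + (of_real lam * c) \<cdot>\<^sub>m ?t (mat_adjoint Mp * (A * m0)) + ((of_real lam)\<^sup>2 * d) \<cdot>\<^sub>m ?t (mat_adjoint Mp * (A * Mp))"
      using m0 M A W l
      by (intro smult_combination_4[of _ n] ten_carrier mult_carrier_mat[of _ 2 2]) auto
    also have "\<dots> = ten k (Suc l) ?Xi proj_vac"
      using m0 M A W l by (simp add: ten_add_left ten_smult_left sq_carrier[where n = 2] assoc_mult_mat[of _ 2 2 _ 2 _ 2])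
    finally show ?thesis .
  qed
  \<comment> \<open>A vacuum projection is inserted on each side. Both will pass through
    \<open>U l\<close> and C, which do not touch factor l + 1, up to the unitary of step l +
    1.\<close>
  have "?P (mat_adjoint (U (Suc l)) * ?Z * U (Suc l) * C)
      = ?P (?E * (mat_adjoint (U (Suc l)) * ?Z * U (Suc l) * C) * ?E)"
    using car Mi_ten(1)[OF l'(1)] unfolding U_Suc
    by (simp only: emb_vac_null[OF \<rho> l'(1)] sq_carrier[where n = n])
  also have "?E * (mat_adjoint (U (Suc l)) * ?Z * U (Suc l) * C) * ?E
      = (?E * mat_adjoint ?V) * (mat_adjoint ?M * (?Z * (?M * (?D * ?E))))"
    unfolding U_Suc using car
    by (simp add: mat_adjoint_mult[of _ n n _ n] sq_carrier[where n = n] assoc_mult_mat[of _ n n _ n _ n])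
  also have "\<dots> = mat_adjoint ?V * ((?E * mat_adjoint ?M) * (?Z * (?M * ?E)) * ?D)"
    unfolding comm using car
    by (simp add: sq_carrier[where n = n] assoc_mult_mat[of _ n n _ n _ n])
  also have "\<dots> = mat_adjoint ?V * ((init k ?Xi * ?E) * ?D)"
    unfolding K K' KZK by (simp only: ten_def)
  also have "\<dots> = mat_adjoint ?V * init k ?Xi * (?E * ?D)"
    using car by (simp add: sq_carrier[where n = n] assoc_mult_mat[of _ n n _ n _ n])
  \<comment> \<open>The one projection that is left returns to the outside, where the state absorbs
    it.\<close>
  also have "\<dots> = (j l ?Xi * C) * ?E"
    unfolding comm(2)[symmetric] jmap_def using car by (simp add: sq_carrier[where n = n] assoc_mult_mat[of _ n n _ n _ n])
  also have "?P \<dots> = ?P (j l ?Xi * C)"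
    unfolding jmap_def using car by (intro emb_vac_null \<rho> l'(1)) (simp add: sq_carrier[where n = n])
  finally show ?thesis .
qed

end

text \<open>Scalars on one atom: v = lam^2 and u = +lam or -lam is the observed increment; a, e, c,
  d, b are the old filter of X, L(X), X + lam^2 L(X), J(X), J(I); f is the new filter of X and r the
  quotient. The assumption on f is Bayes' rule. Since D = (1 - u b)(1 + u b), only 1 - u b can make
  D vanish, and the innovation u - b v = u (1 - u b) vanishes with it.\<close>

lemma filter_arithmetic:
  fixes a b c d e f r u v D :: complex
  assumes v: "v = u\<^sup>2" and c: "c = a + v * e" and f: "f * (1 + u * b) = c + u * d"
    and nz: "1 + u * b \<noteq> 0" and sibling: "1 - u * b = 0 \<Longrightarrow> c = u * d"
    and D: "D = 1 - v * (b * b)" and r: "D * (D * r) = D * (d - c * b)"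
  shows "f - a - (e * v + r * (u - b * v)) = 0"
proof (cases "1 - u * b = 0")
  case True
  then have ub: "u * b = 1" by simp
  have "f * 2 = c * 2" using f sibling[OF True] ub by simp
  then have "f = c" by simp
  moreover have "u - b * v = u * (1 - u * b)" by (simp add: v power2_eq_square algebra_simps)
  ultimately show ?thesis by (simp add: True c)
next
  case False
  have D': "D = (1 - u * b) * (1 + u * b)" by (simp add: D v power2_eq_square algebra_simps)
  then have Dr: "d - c * b = D * r" using r False nz by simp
  have "(f - c) * (1 + u * b) = u * (d - c * b)"
    using f by (simp add: algebra_simps)
  also have "\<dots> = r * u * (1 - u * b) * (1 + u * b)"
    unfolding Dr D' by simp
  finally have "(f - c) * (1 + u * b) = r * u * (1 - u * b) * (1 + u * b)" .
  then have "f - c = r * u * (1 - u * b)" using nz by simp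
  then show ?thesis by (simp add: c v power2_eq_square algebra_simps)
qed

lemma Lgen_carrier [simp]:
  "Mp \<in> carrier_mat 2 2 \<Longrightarrow> Mo \<in> carrier_mat 2 2 \<Longrightarrow> A \<in> carrier_mat 2 2 \<Longrightarrow> Lgen lam Mp Mo A \<in> carrier_mat 2 2"
  unfolding Lgen_def by (simp add: sq_carrier[where n = 2])

lemma Jgen_carrier [simp]:
  "Mp \<in> carrier_mat 2 2 \<Longrightarrow> Mo \<in> carrier_mat 2 2 \<Longrightarrow> A \<in> carrier_mat 2 2 \<Longrightarrow> Jgen lam Mp Mo A \<in> carrier_mat 2 2"
  unfolding Jgen_def by (simp add: sq_carrier[where n = 2])

section \<open>One-step expectations and the filter on atoms\<close>

context repeated_interaction
begin

abbreviation "\<L> \<equiv> Lgen lam Mp Mo"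
abbreviation "\<J> \<equiv> Jgen lam Mp Mo"

lemma j_carrier: "l \<le> k \<Longrightarrow> A \<in> carrier_mat 2 2 \<Longrightarrow> j l A \<in> carrier_mat n n"
  unfolding jmap_def using U_carrier[of l] by (simp add: sq_carrier[where n = n])

lemma j_add:
  "l \<le> k \<Longrightarrow> A \<in> carrier_mat 2 2 \<Longrightarrow> B \<in> carrier_mat 2 2 \<Longrightarrow> j l (A + B) = j l A + j l B"
  unfolding jmap_def using U_carrier[of l]
  by (simp add: sq_linear[where n = n] emb_add del: assoc_mult_mat)

lemma j_smult: "l \<le> k \<Longrightarrow> A \<in> carrier_mat 2 2 \<Longrightarrow> j l (c \<cdot>\<^sub>m A) = c \<cdot>\<^sub>m j l A"
  unfolding jmap_def using U_carrier[of l]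
  by (simp add: sq_linear[where n = n] emb_smult del: assoc_mult_mat)

lemma j_one: "l \<le> k \<Longrightarrow> j l (1\<^sub>m 2) = 1\<^sub>m n"
  unfolding jmap_def using U_carrier[of l] U_unitary[of l]
  by (simp add: emb_one_n right_mult_one_mat[of _ n n])

text \<open>The left side is the Heisenberg evolution over one step averaged over the vacuum. This
  is the origin of L: expanding \<open>m0\<close> leaves A plus terms that all carry lam^2.\<close>

lemma compress_Lgen:
  assumes A: "A \<in> carrier_mat 2 2"
  shows "mat_adjoint m0 * A * m0 + of_real (lam\<^sup>2) \<cdot>\<^sub>m (mat_adjoint Mp * A * Mp) = A + of_real (lam\<^sup>2) \<cdot>\<^sub>m \<L> A"
proof -
  let ?t = "complex_of_real (lam\<^sup>2)"
  have car: "Mp \<in> carrier_mat 2 2" "Mo \<in> carrier_mat 2 2" "mat_adjoint Mp \<in> carrier_mat 2 2" "mat_adjoint Mo \<in> carrier_mat 2 2"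
    using M by simp_all
  have "mat_adjoint m0 * A * m0 = (1\<^sub>m 2 + ?t \<cdot>\<^sub>m mat_adjoint Mo) * (A * m0)"
    using car A by (simp add: mat_adjoint_add[of _ 2 2] mat_adjoint_smult assoc_mult_mat[of _ 2 2 _ 2 _ 2] sq_carrier[where n = 2])
  also have "A * m0 = A + ?t \<cdot>\<^sub>m (A * Mo)"
    using car A by (simp add: mult_add_distrib_mat[of _ 2 2 _ 2] mult_smult_distrib[of _ 2 2 _ 2] right_mult_one_mat[of _ 2 2])
  also have "(1\<^sub>m 2 + ?t \<cdot>\<^sub>m mat_adjoint Mo) * (A + ?t \<cdot>\<^sub>m (A * Mo))
    = (A + ?t \<cdot>\<^sub>m (A * Mo)) + (?t \<cdot>\<^sub>m (mat_adjoint Mo * A) + ?t \<cdot>\<^sub>m (?t \<cdot>\<^sub>m (mat_adjoint Mo * (A * Mo))))"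
    using car A
    by (subst mult_add_add_mat[of _ 2]) (simp_all add: sq_carrier[where n = 2] mult_smult_distrib[of _ 2 2 _ 2]
        mult_smult_assoc_mat[of _ 2 2 _ 2] left_mult_one_mat[of _ 2 2])
  finally show ?thesis
    using car A unfolding Lgen_def
    by (intro eq_matI) (simp_all add: sq_carrier[where n = 2] assoc_mult_mat[of _ 2 2 _ 2 _ 2] algebra_simps
        del: index_mult_mat(1))
qed

text \<open>J collects the cross terms, in which exactly one of the two unitaries has created an
  excitation, paired by sigma_x with the vacuum.\<close>

lemma compress_Jgen:
  assumes A: "A \<in> carrier_mat 2 2"
  shows "of_real (lam\<^sup>2) \<cdot>\<^sub>m (mat_adjoint m0 * A * Mp) + of_real (lam\<^sup>2) \<cdot>\<^sub>m (mat_adjoint Mp * A * m0)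
    = of_real (lam\<^sup>2) \<cdot>\<^sub>m \<J> A"
proof -
  let ?t = "complex_of_real (lam\<^sup>2)"
  have car: "Mp \<in> carrier_mat 2 2" "Mo \<in> carrier_mat 2 2" "mat_adjoint Mp \<in> carrier_mat 2 2" "mat_adjoint Mo \<in> carrier_mat 2 2"
    using M by simp_all
  have "mat_adjoint m0 * A * Mp = A * Mp + ?t \<cdot>\<^sub>m (mat_adjoint Mo * (A * Mp))"
    using car A by (simp add: mat_adjoint_add[of _ 2 2] mat_adjoint_smult sq_linear[where n = 2] left_mult_one_mat[of _ 2 2])
  moreover have "mat_adjoint Mp * A * m0 = mat_adjoint Mp * A + ?t \<cdot>\<^sub>m (mat_adjoint Mp * (A * Mo))"
    using car A by (simp add: sq_linear[where n = 2] right_mult_one_mat[of _ 2 2])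
  ultimately show ?thesis
    using car A unfolding Jgen_def
    by (intro eq_matI) (simp_all add: sq_carrier[where n = 2] assoc_mult_mat[of _ 2 2 _ 2 _ 2] algebra_simps
        del: index_mult_mat(1))
qed

lemma expectation_j_Suc:
  assumes \<rho>: "is_state 2 \<rho>" and l: "Suc l \<le> k" and C: "C \<in> Y l" and A: "A \<in> carrier_mat 2 2"
  shows "total_state k \<rho> (j (Suc l) A * C) = total_state k \<rho> (j l (A + of_real (lam\<^sup>2) \<cdot>\<^sub>m \<L> A) * C)"
proof -
  have "total_state k \<rho> (mat_adjoint (U (Suc l)) * ten k (Suc l) A (1\<^sub>m 2) * U (Suc l) * C)
    = total_state k \<rho> (j l (1 \<cdot>\<^sub>m (mat_adjoint m0 * A * m0) + (of_real lam * 0) \<cdot>\<^sub>m (mat_adjoint m0 * A * Mp)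
        + (of_real lam * 0) \<cdot>\<^sub>m (mat_adjoint Mp * A * m0)
        + (of_real (lam\<^sup>2) * 1) \<cdot>\<^sub>m (mat_adjoint Mp * A * Mp)) * C)"
    by (rule vac_expectation[OF \<rho> l C A])
      (simp_all add: left_mult_one_mat[of _ 2 2] spin_mult one_smult_mat zero_smult_mat[of _ 2 2]
        proj_vac_def[symmetric])
  moreover have "1 \<cdot>\<^sub>m (mat_adjoint m0 * A * m0) + (of_real lam * 0) \<cdot>\<^sub>m (mat_adjoint m0 * A * Mp)
        + (of_real lam * 0) \<cdot>\<^sub>m (mat_adjoint Mp * A * m0)
        + (of_real (lam\<^sup>2) * 1) \<cdot>\<^sub>m (mat_adjoint Mp * A * Mp)
      = mat_adjoint m0 * A * m0 + of_real (lam\<^sup>2) \<cdot>\<^sub>m (mat_adjoint Mp * A * Mp)"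
    using A M by (intro eq_matI) (auto simp del: index_mult_mat(1))
  ultimately show ?thesis
    using l A by (simp only: compress_Lgen[OF A] ten_one_right jmap_def)
qed

text \<open>One factor lam comes from the creation term of the unitary, the other from the measured
  quadrature.\<close>

lemma expectation_j_Suc_x:
  assumes \<rho>: "is_state 2 \<rho>" and l: "Suc l \<le> k" and C: "C \<in> Y l" and A: "A \<in> carrier_mat 2 2"
  shows "total_state k \<rho> (j (Suc l) A * (C * x (Suc l))) = of_real (lam\<^sup>2) * total_state k \<rho> (j l (\<J> A) * C)"
proof -
  have P: "is_state n (total_state k \<rho>)" using total_state_is_state[OF \<rho>] n by simp
  have lk: "l \<le> k" using l by simp
  have car: "C \<in> carrier_mat n n" "x (Suc l) \<in> carrier_mat n n" "j (Suc l) A \<in> carrier_mat n n"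
    using Y_carrier[OF lk C] x_carrier j_carrier l A by auto
  have "C * x (Suc l) = x (Suc l) * C"
    using l by (intro Y_commute[OF Y_mono[OF lk C]] star_alg_gen) auto
  then have "j (Suc l) A * (C * x (Suc l)) = (j (Suc l) A * x (Suc l)) * C"
    using assoc_mult_mat[OF car(3,2,1)] by simp
  also have "j (Suc l) A * x (Suc l) = mat_adjoint (U (Suc l)) * ten k (Suc l) A (sigma_x lam) * U (Suc l)"
    using x_U[of "Suc l" "Suc l"] l A unfolding jmap_def by (simp add: conj_mult ten_def)
  also have "total_state k \<rho> (mat_adjoint (U (Suc l)) * ten k (Suc l) A (sigma_x lam) * U (Suc l) * C)
    = total_state k \<rho> (j l (0 \<cdot>\<^sub>m (mat_adjoint m0 * A * m0) + (of_real lam * of_real lam) \<cdot>\<^sub>m (mat_adjoint m0 * A * Mp)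
        + (of_real lam * of_real lam) \<cdot>\<^sub>m (mat_adjoint Mp * A * m0)
        + (of_real (lam\<^sup>2) * 0) \<cdot>\<^sub>m (mat_adjoint Mp * A * Mp)) * C)"
    by (rule vac_expectation[OF \<rho> l C A]) (simp_all add: spin_mult zero_smult_mat[of _ 2 2])
  also have "0 \<cdot>\<^sub>m (mat_adjoint m0 * A * m0) + (of_real lam * of_real lam) \<cdot>\<^sub>m (mat_adjoint m0 * A * Mp)
        + (of_real lam * of_real lam) \<cdot>\<^sub>m (mat_adjoint Mp * A * m0)
        + (of_real (lam\<^sup>2) * 0) \<cdot>\<^sub>m (mat_adjoint Mp * A * Mp)
      = of_real (lam\<^sup>2) \<cdot>\<^sub>m (mat_adjoint m0 * A * Mp) + of_real (lam\<^sup>2) \<cdot>\<^sub>m (mat_adjoint Mp * A * m0)"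
    using A M by (intro eq_matI) (auto simp: power2_eq_square simp del: index_mult_mat(1))
  also have "\<dots> = of_real (lam\<^sup>2) \<cdot>\<^sub>m \<J> A" by (rule compress_Jgen[OF A])
  also have "total_state k \<rho> (j l (of_real (lam\<^sup>2) \<cdot>\<^sub>m \<J> A) * C) = of_real (lam\<^sup>2) * total_state k \<rho> (j l (\<J> A) * C)"
    using M A car j_carrier[OF lk]
    by (simp add: j_smult[OF lk] mult_smult_assoc_mat[of _ n n _ n] state_smult[OF P] sq_carrier[where n = n])
  finally show ?thesis .
qed

declare atom.simps(2) [simp del]

text \<open>Writing h as half of 1 plus or minus x / lam reduces a half-atom to the two preceding
  expectations. For A = I it yields the probabilities of the two possible outcomes.\<close>

lemma expectation_half_atom:
  assumes \<rho>: "is_state 2 \<rho>" and l: "Suc l \<le> k" and A: "A \<in> carrier_mat 2 2"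
  shows "total_state k \<rho> (j (Suc l) A * (atom s l * h \<beta> (Suc l)))
    = (total_state k \<rho> (j l (A + of_real (lam\<^sup>2) \<cdot>\<^sub>m \<L> A) * atom s l)
      + sg \<beta> * of_real lam * total_state k \<rho> (j l (\<J> A) * atom s l)) / 2"
proof -
  let ?P = "total_state k \<rho>" and ?Q = "atom s l"
  have P: "is_state n ?P" using total_state_is_state[OF \<rho>] n by simp
  have car: "?Q \<in> carrier_mat n n" "x (Suc l) \<in> carrier_mat n n" "j (Suc l) A \<in> carrier_mat n n"
    using atom_carrier x_carrier j_carrier l A by auto
  have "j (Suc l) A * (?Q * h \<beta> (Suc l)) = (1 / 2) \<cdot>\<^sub>m (j (Suc l) A * ?Q)
      + (sg \<beta> / (2 * of_real lam)) \<cdot>\<^sub>m (j (Suc l) A * (?Q * x (Suc l)))"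
    unfolding h_def using car by (simp add: sq_linear[where n = n] right_mult_one_mat[of _ n n])
  then have "?P (j (Suc l) A * (?Q * h \<beta> (Suc l))) = ?P (j (Suc l) A * ?Q) / 2
      + sg \<beta> / (2 * of_real lam) * ?P (j (Suc l) A * (?Q * x (Suc l)))"
    using car by (simp add: state_add[OF P] state_smult[OF P] sq_carrier[where n = n] del: assoc_mult_mat)
  also have "\<dots> = ?P (j l (A + of_real (lam\<^sup>2) \<cdot>\<^sub>m \<L> A) * ?Q) / 2
      + sg \<beta> / (2 * of_real lam) * (of_real (lam\<^sup>2) * ?P (j l (\<J> A) * ?Q))"
    by (simp only: expectation_j_Suc[OF \<rho> l atom_in_Y A] expectation_j_Suc_x[OF \<rho> l atom_in_Y A])
  finally show ?thesis using lam by (simp add: power2_eq_square field_simps)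
qed

text \<open>
  The equation is checked on one atom \<open>atom s k\<close> of the observation algebra at a time, where all
  its terms are scalars. Only atoms of positive probability matter.\<close>

theorem filtering_equation:
  assumes \<rho>: "is_state 2 \<rho>" and l: "Suc l \<le> k" and X: "X \<in> carrier_mat 2 2"
    and filter: "\<And>i Z. i \<le> k \<Longrightarrow> Z \<in> carrier_mat 2 2 \<Longrightarrow> is_cond_exp (total_state k \<rho>) (Y i) (j i Z) (\<pi> i Z)"
    and R: "is_quotient n (Y k)
      (\<pi> l (\<J> X) - \<pi> l (X + of_real (lam\<^sup>2) \<cdot>\<^sub>m \<L> X) * \<pi> l (\<J> (1\<^sub>m 2)))
      (1\<^sub>m n - of_real (lam\<^sup>2) \<cdot>\<^sub>m (\<pi> l (\<J> (1\<^sub>m 2)) * \<pi> l (\<J> (1\<^sub>m 2)))) R"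
  shows "as_eq (total_state k \<rho>) (\<pi> (Suc l) X - \<pi> l X)
    (\<pi> l (\<L> X) * dt k lam (Suc l)
      + R * (x (Suc l) - \<pi> l (\<J> (1\<^sub>m 2)) * dt k lam (Suc l)))"
proof -
  let ?P = "total_state k \<rho>" and ?t = "complex_of_real (lam\<^sup>2)" and ?I = "1\<^sub>m 2 :: complex mat"
  let ?B = "\<pi> l (\<J> ?I)" and ?C = "\<pi> l (X + ?t \<cdot>\<^sub>m \<L> X)"
  define D where "D = 1\<^sub>m n - ?t \<cdot>\<^sub>m (?B * ?B)"
  define N where "N = \<pi> l (\<J> X) - ?C * ?B"
  \<comment> \<open>The difference of the two sides; the goal is that P vanishes on W^* W.\<close>
  define W where "W = (\<pi> (Suc l) X - \<pi> l X)
    - (\<pi> l (\<L> X) * dt k lam (Suc l) + R * (x (Suc l) - ?B * dt k lam (Suc l)))"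
  have P: "is_state n ?P" using total_state_is_state[OF \<rho>] n by simp
  have lk: "l \<le> k" using l by simp
  have I: "?I \<in> carrier_mat 2 2" by simp
  have \<pi>_Y: "\<pi> i Z \<in> Y i" and \<pi>_P: "K \<in> Y i \<Longrightarrow> ?P (\<pi> i Z * K) = ?P (j i Z * K)"
    if "i \<le> k" "Z \<in> carrier_mat 2 2" for i Z K
    using filter[OF that] by (auto simp: is_cond_exp_def)
  have car2: "\<J> Z \<in> carrier_mat 2 2" "\<L> Z \<in> carrier_mat 2 2" "Z + ?t \<cdot>\<^sub>m \<L> Z \<in> carrier_mat 2 2"
    if "Z \<in> carrier_mat 2 2" for Z
    using that M by simp_all
  have pY: "\<pi> l Z \<in> Y k" if "Z \<in> carrier_mat 2 2" for Z
    by (rule Y_mono[OF lk \<pi>_Y[OF lk that]])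
  have pc: "\<pi> l Z \<in> carrier_mat n n" if "Z \<in> carrier_mat 2 2" for Z
    by (rule Y_carrier[OF order_refl pY[OF that]])
  have S: "x ` {1..k} \<subseteq> carrier_mat n n" by (rule gen_subset) simp
  have D_Y: "D \<in> Y k" and N_Y: "N \<in> Y k"
    unfolding D_def N_def using pY car2 X I
    by (intro star_alg_minus[OF S] star_alg_one star_alg_smult star_alg_mult; simp)+
  have R_Y: "R \<in> Y k" using R by (simp add: is_quotient_def)
  have dt: "dt k lam (Suc l) = ?t \<cdot>\<^sub>m 1\<^sub>m n" by (simp add: dt_def n)
  have x_Y: "x (Suc l) \<in> Y k" using l by (intro star_alg_gen imageI) simp
  have W_Y: "W \<in> Y k"
    unfolding W_def dt
    by (intro star_alg_minus[OF S] star_alg_add star_alg_mult star_alg_smult star_alg_one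
        pY car2 X I R_Y x_Y Y_mono[OF l \<pi>_Y[OF l X]])
  have Wc: "W \<in> carrier_mat n n" by (rule Y_carrier[OF order_refl W_Y])
  have DDR: "D * (D * R) = D * N"
    using quotient_mult[OF S R[folded D_def N_def] N_Y D_Y] .
  have "?P (mat_adjoint W * W * atom s k) = 0" for s
  proof -
    let ?Q = "atom s k" and ?Ql = "atom s l" and ?Qs = "atom s (Suc l)"
    have Qc: "?Q \<in> carrier_mat n n" "?Ql \<in> carrier_mat n n" "?Qs \<in> carrier_mat n n"
      by (rule atom_carrier; use l in simp)+
    \<comment> \<open>A projection of probability zero is null in the sense of the Cauchy-Schwarz
      argument, since it equals its own square.\<close>
    have null: "?P (K * A) = 0" if "A \<in> carrier_mat n n" "mat_adjoint A = A" "A * A = A" "?P A = 0" "K \<in> carrier_mat n n" for A K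
      using state_null_left_right(1)[OF P that(1,5)] that by simp
    have atom_null: "?P (K * atom t i) = 0" if "i \<le> k" "?P (atom t i) = 0" "K \<in> carrier_mat n n" for t i K
      using that by (intro null atom_carrier atom_adjoint atom_idem) auto
    obtain w where w: "eig W ?Q w" using Y_atom[OF order_refl W_Y] by blast
    have "mat_adjoint W * W * ?Q = w \<cdot>\<^sub>m (mat_adjoint W * ?Q)"
      using w Wc Qc by (simp add: eig_def assoc_mult_mat[of _ n n _ n _ n] mult_smult_distrib[of _ n n _ n])
    then have PW: "?P (mat_adjoint W * W * ?Q) = w * ?P (mat_adjoint W * ?Q)"
      using Wc Qc by (simp add: state_smult[OF P] sq_carrier[where n = n])
    show ?thesis
    proof (cases "?P ?Q = 0")
      case True
      then show ?thesis using PW atom_null[OF order_refl True, of "mat_adjoint W"] Wc by simp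
    next
      case False
      \<comment> \<open>Earlier atoms with the same signs absorb the final one, so they cannot have
        probability zero either.\<close>
      have nz: "?P (atom s i) \<noteq> 0" if "i \<le> k" for i
      proof
        assume "?P (atom s i) = 0"
        then have "?P (?Q * atom s i) = 0" by (rule atom_null[OF that _ Qc(1)])
        also have "?Q * atom s i = atom s i * ?Q"
          by (rule Y_commute[OF atom_in_Y Y_mono[OF that atom_in_Y]])
        finally show False using False by (simp add: atom_idem that)
      qed
      have Q_nz: "?Q \<noteq> 0\<^sub>m n n"
      proof
        assume "?Q = 0\<^sub>m n n"
        then have "?Q = 0 \<cdot>\<^sub>m 1\<^sub>m n" by (simp add: zero_smult_mat[of _ n n])
        then have "?P ?Q = 0 * ?P (1\<^sub>m n)" by (simp only: state_smult[OF P one_carrier_mat])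
        then show False using False by simp
      qed
      \<comment> \<open>The old filter as a scalar on the atom of time l, for all observables at
        once. Nothing makes this choice linear in Z a priori.\<close>
      define ev where "ev Z = (SOME c. eig (\<pi> l Z) ?Ql c)" for Z
      have ev0: "eig (\<pi> l Z) ?Ql (ev Z)" if "Z \<in> carrier_mat 2 2" for Z
        unfolding ev_def using Y_atom[OF lk \<pi>_Y[OF lk that]] by (rule someI_ex)
      have ev: "eig (\<pi> l Z) ?Q (ev Z)" if "Z \<in> carrier_mat 2 2" for Z
        by (rule eig_atom_mono[OF lk order_refl pc[OF that] ev0[OF that]])
      have P_ev: "?P (j l Z * ?Ql) = ev Z * ?P ?Ql" if "Z \<in> carrier_mat 2 2" for Z
      proof -
        have "?P (j l Z * ?Ql) = ?P (\<pi> l Z * ?Ql)" using \<pi>_P[OF lk that atom_in_Y] by simp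
        also have "\<dots> = ev Z * ?P ?Ql" using ev0[OF that] Qc by (simp add: eig_def state_smult[OF P])
        finally show ?thesis .
      qed
      have half: "?P (j (Suc l) Z * (?Ql * h \<beta> (Suc l))) = (ev (Z + ?t \<cdot>\<^sub>m \<L> Z) + sg \<beta> * of_real lam * ev (\<J> Z)) / 2 * ?P ?Ql"
        if "Z \<in> carrier_mat 2 2" for Z \<beta>
        unfolding expectation_half_atom[OF \<rho> l that] P_ev[OF car2(1)[OF that]] P_ev[OF car2(3)[OF that]]
        by (simp add: algebra_simps)
      \<comment> \<open>Normalisation is obtained from j(I) = 1 at time l + 1, so no algebraic
        relation between the coefficients is required.\<close>
      have "?P (j l (?I + ?t \<cdot>\<^sub>m \<L> ?I) * ?Ql) = ?P (j (Suc l) ?I * ?Ql)"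
        by (rule expectation_j_Suc[OF \<rho> l atom_in_Y I, symmetric])
      also have "\<dots> = ?P ?Ql" using l Qc by (simp add: j_one left_mult_one_mat[of _ n n])
      finally have ev_one: "ev (?I + ?t \<cdot>\<^sub>m \<L> ?I) = 1"
        using P_ev[OF car2(3)[OF I]] nz[OF lk] by simp
      have half_one: "?P (?Ql * h \<beta> (Suc l)) = (1 + sg \<beta> * of_real lam * ev (\<J> ?I)) / 2 * ?P ?Ql" for \<beta>
        using half[OF I, of \<beta>] l Qc h_carrier[of "Suc l" \<beta>] unfolding ev_one
        by (simp add: j_one left_mult_one_mat[of _ n n] sq_carrier[where n = n])
      obtain f where f: "eig (\<pi> (Suc l) X) ?Qs f" using Y_atom[OF l \<pi>_Y[OF l X]] by blast
      obtain r where r: "eig R ?Q r" using Y_atom[OF order_refl R_Y] by blast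
      define u where "u = sg (s l) * complex_of_real lam"
      have "f * ?P ?Qs = ?P (j (Suc l) X * ?Qs)"
        using \<pi>_P[OF l X atom_in_Y, of s] f Qc by (simp add: eig_def state_smult[OF P])
      \<comment> \<open>Bayes' rule before cancelling: the new filter times the probability of the
        observed half equals the expectation of X on that half.\<close>
      then have "f * ((1 + u * ev (\<J> ?I)) / 2 * ?P ?Ql) = (ev (X + ?t \<cdot>\<^sub>m \<L> X) + u * ev (\<J> X)) / 2 * ?P ?Ql"
        using half[OF X, of "s l"] half_one[of "s l"] by (simp add: u_def atom.simps(2))
      then have f_eq: "f * (1 + u * ev (\<J> ?I)) = ev (X + ?t \<cdot>\<^sub>m \<L> X) + u * ev (\<J> X)"
        using nz[OF lk] by simp
      have nz1: "1 + u * ev (\<J> ?I) \<noteq> 0"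
        using nz[OF l] half_one[of "s l"] by (auto simp: u_def atom.simps(2))
      \<comment> \<open>If 1 - u b = 0, the half with the opposite outcome has probability zero, so
        the expectation of X on it vanishes as well.\<close>
      have sibling: "ev (X + ?t \<cdot>\<^sub>m \<L> X) = u * ev (\<J> X)" if "1 - u * ev (\<J> ?I) = 0"
      proof -
        let ?s = "s(l := \<not> s l)"
        have s: "atom ?s (Suc l) = ?Ql * h (\<not> s l) (Suc l)"
          by (simp add: atom.simps atom_cong[of l ?s s])
        have sg: "sg (\<not> s l) * complex_of_real lam = - u" by (simp add: u_def sg_def)
        have "?P (atom ?s (Suc l)) = 0"
          unfolding s half_one sg using that by simp
        then have "?P (j (Suc l) X * atom ?s (Suc l)) = 0"
          by (rule atom_null[OF l _ j_carrier[OF l X]])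
        then show ?thesis
          unfolding s half[OF X] sg using nz[OF lk] by simp
      qed
      \<comment> \<open>Linearity of the filter on this atom is recovered from linearity of the
        expectation, dividing by the nonzero probability of the atom.\<close>
      have "ev (X + ?t \<cdot>\<^sub>m \<L> X) * ?P ?Ql = ?P (j l (X + ?t \<cdot>\<^sub>m \<L> X) * ?Ql)"
        by (rule P_ev[OF car2(3)[OF X], symmetric])
      also have "\<dots> = ?P (j l X * ?Ql) + ?t * ?P (j l (\<L> X) * ?Ql)"
        using X car2 j_carrier[OF lk] Qc
        by (simp add: j_add[OF lk] j_smult[OF lk] add_mult_distrib_mat[of _ n n _ _ n] mult_smult_assoc_mat[of _ n n _ n]
            state_add[OF P] state_smult[OF P] sq_carrier[where n = n])
      also have "\<dots> = (ev X + ?t * ev (\<L> X)) * ?P ?Ql"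
        by (simp add: P_ev[OF X] P_ev[OF car2(2)[OF X]] algebra_simps)
      finally have c_eq: "ev (X + ?t \<cdot>\<^sub>m \<L> X) = ev X + ?t * ev (\<L> X)"
        using nz[OF lk] by simp
      have D_eig: "eig D ?Q (1 - ?t * (ev (\<J> ?I) * ev (\<J> ?I)))"
        unfolding D_def using pc car2 I Qc
        by (intro eig_minus[of _ n] eig_smult[of _ n] eig_mult[of _ n] eig_one ev) (simp_all add: sq_carrier[where n = n])
      have N_eig: "eig N ?Q (ev (\<J> X) - ev (X + ?t \<cdot>\<^sub>m \<L> X) * ev (\<J> ?I))"
        unfolding N_def using pc car2 I X Qc
        by (intro eig_minus[of _ n] eig_mult[of _ n] ev) (simp_all add: sq_carrier[where n = n])
      define D' where "D' = 1 - ?t * (ev (\<J> ?I) * ev (\<J> ?I))"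
      have car: "D \<in> carrier_mat n n" "N \<in> carrier_mat n n" "R \<in> carrier_mat n n"
        using Y_carrier[OF order_refl] D_Y N_Y R_Y by auto
      have "eig (D * (D * R)) ?Q (D' * (D' * r))"
        using car Qc D_eig r unfolding D'_def
        by (intro eig_mult[of _ n]) (simp_all add: sq_carrier[where n = n])
      moreover have "eig (D * N) ?Q (D' * (ev (\<J> X) - ev (X + ?t \<cdot>\<^sub>m \<L> X) * ev (\<J> ?I)))"
        using car Qc D_eig N_eig unfolding D'_def by (intro eig_mult[of _ n])
      ultimately have r_eq: "D' * (D' * r) = D' * (ev (\<J> X) - ev (X + ?t \<cdot>\<^sub>m \<L> X) * ev (\<J> ?I))"
        using eig_unique[OF Qc(1) Q_nz] unfolding DDR by blast
      have x_eig: "eig (x (Suc l)) ?Q u"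
        unfolding u_def using l by (intro x_atom) auto
      have f_eig: "eig (\<pi> (Suc l) X) ?Q f"
        by (rule eig_atom_mono[OF l order_refl Y_carrier[OF l \<pi>_Y[OF l X]] f])
      \<comment> \<open>The factors \<open>?t * 1\<close> arise because the time increment is a
        multiple of the identity, whose eigenvalue is 1.\<close>
      have "eig W ?Q (f - ev X - (ev (\<L> X) * (?t * 1) + r * (u - ev (\<J> ?I) * (?t * 1))))"
        unfolding W_def dt using pc car2 I X Qc car x_carrier[of "Suc l"] l Y_carrier[OF l \<pi>_Y[OF l X]]
        by (intro eig_minus[of _ n] eig_add[of _ n] eig_mult[of _ n] eig_smult[of _ n] eig_one ev x_eig f_eig r)
          (simp_all add: sq_carrier[where n = n] minus_carrier_mat)
      moreover have "f - ev X - (ev (\<L> X) * ?t + r * (u - ev (\<J> ?I) * ?t)) = 0"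
        by (rule filter_arithmetic[OF _ c_eq f_eq nz1 sibling D'_def r_eq])
          (auto simp: u_def sg_def power_mult_distrib)
      ultimately have "w = 0"
        using eig_unique[OF Qc(1) Q_nz w] by simp
      then show ?thesis using PW by simp
    qed
  qed
  \<comment> \<open>The atoms sum to the identity, so the contributions of the single atoms add up
    to the whole expectation.\<close>
  then have "?P (mat_adjoint W * W * 1\<^sub>m n) = 0"
    using Wc
    by (intro one_by_atoms[of "\<lambda>Z. ?P (mat_adjoint W * W * Z) = 0"])
      (simp_all add: mult_add_distrib_mat[of _ n n _ n] state_add[OF P] sq_carrier[where n = n] del: assoc_mult_mat)
  then show ?thesis
    using Wc unfolding as_eq_def W_def by (simp add: right_mult_one_mat[of _ n n] sq_carrier[where n = n])
qed

end

text \<open>Existence of a quotient is part of the claim, so that the equation for every quotient,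
  whatever its values at zeros of the denominator, is not vacuous.\<close>

theorem mainTheorem1:
  fixes k l :: nat and T lam :: real
    and \<rho> :: "complex mat \<Rightarrow> complex"
    and L1 L2 L3 Mpm Mp Mm Mo X :: "complex mat"
    and \<pi> :: "nat \<Rightarrow> complex mat \<Rightarrow> complex mat"
  assumes T: "T > 0" and lam: "lam = sqrt (T / real k)"
    and state: "is_state 2 \<rho>"
    and L: "L1 \<in> carrier_mat 2 2" "L2 \<in> carrier_mat 2 2" "L3 \<in> carrier_mat 2 2"
    and selfadjoint: "mat_adjoint L1 = L1" "mat_adjoint L3 = L3"
    and M: "Mpm \<in> carrier_mat 2 2" "Mp \<in> carrier_mat 2 2"
      "Mm \<in> carrier_mat 2 2" "Mo \<in> carrier_mat 2 2"
    and M_eq: "\<And>i. i \<in> {1..k} \<Longrightarrow>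
      Mint k lam L1 L2 L3 i - 1\<^sub>m (dimn k) =
        init k Mpm * dLam k i + init k Mp * dAstar k lam i
          + init k Mm * dA k lam i + init k Mo * dt k lam i"
    and filter: "\<And>i Z. i \<le> k \<Longrightarrow> Z \<in> carrier_mat 2 2 \<Longrightarrow>
      is_cond_exp (total_state k \<rho>) (Yalg k lam L1 L2 L3 i) (jmap k lam L1 L2 L3 i Z) (\<pi> i Z)"
    and X: "X \<in> carrier_mat 2 2"
    and l: "l \<in> {1..k}"
  shows
    "let \<L> = Lgen lam Mp Mo; \<J> = Jgen lam Mp Mo;
         p = \<pi> (l - 1); I = 1\<^sub>m 2 :: complex mat;
         N = p (\<J> X) - p (X + complex_of_real (lam\<^sup>2) \<cdot>\<^sub>m \<L> X) * p (\<J> I);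
         D = 1\<^sub>m (dimn k) - complex_of_real (lam\<^sup>2) \<cdot>\<^sub>m (p (\<J> I) * p (\<J> I));
         Y = Yalg k lam L1 L2 L3 k
     in (\<exists>R. is_quotient (dimn k) Y N D R) \<and>
        (\<forall>R. is_quotient (dimn k) Y N D R \<longrightarrow>
           as_eq (total_state k \<rho>)
             (\<pi> l X - p X)
             (p (\<L> X) * dt k lam l
               + R * (dY k lam L1 L2 L3 l - p (\<J> I) * dt k lam l)))"
proof -
  obtain r where r: "l = Suc r" "Suc r \<le> k"
    using l by (cases l) auto
  \<comment> \<open>Here k is positive because 1 <= l <= k, hence T / k > 0.\<close>
  have "lam \<noteq> 0"
    using T r unfolding lam by simp
  then interpret repeated_interaction k "dimn k" lam L1 L2 L3 Mpm Mp Mm Mo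
    using L selfadjoint M M_eq by unfold_locales (rule refl)
  have "as_eq (total_state k \<rho>) (\<pi> (Suc r) X - \<pi> r X)
      (\<pi> r (Lgen lam Mp Mo X) * dt k lam (Suc r)
        + R * (dY k lam L1 L2 L3 (Suc r) - \<pi> r (Jgen lam Mp Mo (1\<^sub>m 2)) * dt k lam (Suc r)))"
    if "is_quotient (dimn k) (Yalg k lam L1 L2 L3 k)
      (\<pi> r (Jgen lam Mp Mo X) - \<pi> r (X + complex_of_real (lam\<^sup>2) \<cdot>\<^sub>m Lgen lam Mp Mo X)
        * \<pi> r (Jgen lam Mp Mo (1\<^sub>m 2)))
      (1\<^sub>m (dimn k) - complex_of_real (lam\<^sup>2) \<cdot>\<^sub>m
        (\<pi> r (Jgen lam Mp Mo (1\<^sub>m 2)) * \<pi> r (Jgen lam Mp Mo (1\<^sub>m 2)))) R" for R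
    using that filter unfolding Yalg_def by (intro filtering_equation[OF state r(2) X])
  then show ?thesis
    using quotient_exists unfolding Let_def r(1) diff_Suc_1 Yalg_def by blast
qed

end
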